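(* Let $R$ be a finite chain ring of length $2$ with residue field $\mathbb{F}_q$, where $q\ge5$ is a prime power. Then $$\mathrm{m}_3(R)\le\begin{cases}2q^2-2q+4 & \text{if } q \text{ is odd},\\ 2q^2-q+4 & \text{if } q \text{ is even}.\end{cases}$$
   Context: Throughout, $R$ is a finite chain ring of nilpotency index (length) $2$, i.e. a finite local ring with radical $\mathrm{rad}R\neq 0$, $(\mathrm{rad}R)^2=0$, whose one-sided ideals form the chain $R\supsetneq\mathrm{rad}R\supsetneq 0$, with residue field $R/\mathrm{rad}R\cong\mathbb{F}_q$ ($q$ a prime power); then $|R|=q^2$. The projective Hjelmslev plane $\mathrm{PHG}(2,R)$ is the incidence structure whose points are the free rank-$1$ submodules of the right module $R_R^3$, whose lines are the free rank-$2$ submodules of $R_R^3$, with incidence given by inclusion; it has $q^4+q^3+q^2$ points and each line contains $q^2+q$ points. A $(k,n)$-arc is a map $\mathcal{K}$ from the point set to $\mathbb{N}_0$ with $\sum_x\mathcal{K}(x)=k$ and $\sum_{x\in L}\mathcal{K}(x)\le n$ for every line $L$; it is projective if $\mathcal{K}$ takes only values in $\{0,1\}$ (i.e. it is a set of $k$ points meeting every line in at most $n$ points). For $0\le n\le q^2+q$, $\mathrm{m}_n(R)$ denotes the largest $k$ such that a projective $(k,n)$-arc exists in $\mathrm{PHG}(2,R)$. *)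

theory Defs
  imports Main
begin

definition right_ideal :: "'r::ring_1 set \<Rightarrow> bool" where
  "right_ideal I \<longleftrightarrow> 0 \<in> I \<and> (\<forall>a\<in>I. \<forall>b\<in>I. a + b \<in> I) \<and> (\<forall>a\<in>I. - a \<in> I)
     \<and> (\<forall>a\<in>I. \<forall>r. a * r \<in> I)"

definition left_ideal :: "'r::ring_1 set \<Rightarrow> bool" where
  "left_ideal I \<longleftrightarrow> 0 \<in> I \<and> (\<forall>a\<in>I. \<forall>b\<in>I. a + b \<in> I) \<and> (\<forall>a\<in>I. - a \<in> I)
     \<and> (\<forall>a\<in>I. \<forall>r. r * a \<in> I)"

text \<open>The ring (the type 'r) is a chain ring of length 2 with radical N:
  the one-sided ideals form the chain R > N > 0, and N^2 = 0.
  (Then N is the radical, the unique maximal one-sided ideal.)\<close>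

definition chain_ring2 :: "'r::{ring_1,finite} set \<Rightarrow> bool" where
  "chain_ring2 N \<longleftrightarrow> N \<noteq> UNIV \<and> N \<noteq> {0}
     \<and> {I. left_ideal I} = {UNIV, N, {0}}
     \<and> {I. right_ideal I} = {UNIV, N, {0}}
     \<and> (\<forall>a\<in>N. \<forall>b\<in>N. a * b = 0)"

type_synonym 'r vec3 = "'r \<times> 'r \<times> 'r"

definition vadd :: "'r::ring_1 vec3 \<Rightarrow> 'r vec3 \<Rightarrow> 'r vec3" where
  "vadd x y = (fst x + fst y, fst (snd x) + fst (snd y), snd (snd x) + snd (snd y))"

definition vsmul :: "'r::ring_1 vec3 \<Rightarrow> 'r \<Rightarrow> 'r vec3" where
  "vsmul x r = (fst x * r, fst (snd x) * r, snd (snd x) * r)"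

definition hpoints :: "('r::{ring_1,finite} vec3 set) set" where
  "hpoints = {M. \<exists>x. M = {vsmul x r | r. True} \<and> (\<forall>r. vsmul x r = (0,0,0) \<longrightarrow> r = 0)}"

definition hlines :: "('r::{ring_1,finite} vec3 set) set" where
  "hlines = {M. \<exists>x y. M = {vadd (vsmul x r) (vsmul y s) | r s. True}
      \<and> (\<forall>r s. vadd (vsmul x r) (vsmul y s) = (0,0,0) \<longrightarrow> r = 0 \<and> s = 0)}"

definition proj_arc :: "('r::{ring_1,finite} vec3 set) set \<Rightarrow> nat \<Rightarrow> bool" where
  "proj_arc K n \<longleftrightarrow> K \<subseteq> hpoints
     \<and> (\<forall>L\<in>(hlines :: ('r vec3 set) set). card {P\<in>K. P \<subseteq> L} \<le> n)"

definition m_arc :: "nat \<Rightarrow> 'r::{ring_1,finite} itself \<Rightarrow> nat" where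
  "m_arc n _ = Max {card K | K. proj_arc (K :: ('r vec3 set) set) n}"

end

theory Submission
  imports Defs "HOL-Library.Product_Plus"
begin

text \<open>
  For a neighbour class \<open>X\<close> of points (an affine plane of order \<open>q\<close>) and a neighbour class \<open>L\<close>
  of lines through it, let \<open>i\<close> be the largest number of arc points on a segment of \<open>X\<close> in the
  direction \<open>L\<close>. The \<open>q\<close> lines of \<open>L\<close> through that segment cover the other point classes on \<open>L\<close>,
  which therefore carry at most \<open>q (3 - i)\<close> arc points. Summing over the \<open>q + 1\<close> directions gives
  the bound as soon as some class has at least four arc points, because these determine many
  directions; the parity of \<open>q\<close> enters through the parallelograms with parallel diagonals, which
  exist only in characteristic two.

  If all classes have at most three arc points, a segment with two or more of them makes its whole
  line class light, and no two point classes can do this for the same line class. Counting incidences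
  with all line classes then finishes the proof for \<open>3 dvd q\<close>. If \<open>3\<close> does not divide \<open>q\<close>, a line
  class in which every segment has at most one arc point is a \<open>(n, 3)\<close>-arc in a projective plane of
  order \<open>q\<close> with one point removed, and counting bisecants modulo three shows \<open>n \<le> 2 q + 1\<close>. This
  settles everything except \<open>q = 5\<close> with at most two arc points per class, where the
  second moment of the line class weights gives a contradiction.
\<close>

section \<open>Combinatorial Hjelmslev planes\<close>

text \<open>For a class with w arc points and total excess D over its q + 1 directions, the pencil
  argument reads |K| \<le> 2q^2 + 2q + w - qD. The other w - 1 points, seen from any one of them,
  spread over the directions, so D \<ge> w - 1. The extreme case is w = 4: D = 4 gives 2q^2 - 2q +
  4, while D = 3, four points in only three directions, gives 2q^2 - q + 4. Both bounds of the
  theorem originate here; w \<ge> 5 yields less. For w \<le> 3 the same argument is too weak: three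
  points on one segment have D = 2, which gives only 2q^2 + 3. Two things compensate. The cap 2q + 1
  improves the trivial bound w + 2q on a line class without excess. And since a line class has
  excess from at most one point class, point classes with two or three points consume line classes:
  |K| exceeds q^2 + q + 1 by at most the total excess, whereas each unit of excess costs a line
  class about q points. Balancing the two leaves roughly 3q^2/2. For q = 5 and classes of weight at
  most two this stops at 46 while the target is 44, which is why the quadratic estimate is
  needed.\<close>

lemma sum_two_three:
  fixes f :: "'a \<Rightarrow> nat"
  assumes "finite A" "\<And>a. a \<in> A \<Longrightarrow> f a \<in> {0, 2, 3}"
  shows "sum f A = 2 * card {a \<in> A. f a = 2} + 3 * card {a \<in> A. f a = 3}"
proof -
  have "sum f A = (\<Sum>a\<in>A. 2 * of_bool (f a = 2) + 3 * of_bool (f a = 3))"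
    using assms(2) by (intro sum.cong) fastforce+
  also have "\<dots> = 2 * card {a \<in> A. f a = 2} + 3 * card {a \<in> A. f a = 3}"
    using assms(1) by (simp add: sum.distrib sum_distrib_left [symmetric] Int_def)
  finally show ?thesis .
qed

lemma card_eq_1_if_Ex1:
  assumes "\<exists>!x. P x"
  shows "card {x. P x} = 1"
proof -
  from assms obtain a where "P a" "\<And>y. P y \<Longrightarrow> y = a" by blast
  then have "{x. P x} = {a}" by blast
  then show ?thesis by simp
qed

lemma mod_three_cancel_two:
  fixes b q z :: nat
  assumes "2 * b + 3 * z = 2 * q"
  shows "b mod 3 = q mod 3"
proof -
  have "even (2 * b + 3 * z)" unfolding assms by simp
  then obtain w where "z = 2 * w" by (auto elim!: evenE)
  then have "q = b + 3 * w" using assms by simp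
  then show ?thesis by simp
qed

text \<open>\<open>pcl p\<close> is the neighbour class of the point \<open>p\<close>, \<open>Ln L\<close> the set of lines in the line class
  \<open>L\<close>; \<open>I\<close> is incidence of points and lines, \<open>J\<close> incidence of point classes and line classes in the
  factor plane.\<close>

locale hjelmslev =
  fixes Pts :: "'p set" and pcl :: "'p \<Rightarrow> 'x" and PC :: "'x set" and LC :: "'y set"
    and J :: "'x \<Rightarrow> 'y \<Rightarrow> bool" and Ln :: "'y \<Rightarrow> 'l set" and I :: "'p \<Rightarrow> 'l \<Rightarrow> bool"
    and q :: nat
  assumes finite_PC: "finite PC" and finite_LC: "finite LC" and finite_Pts: "finite Pts"
    and finite_Ln: "finite (Ln L)" and PC_nonempty: "PC \<noteq> {}"
    and pcl_in: "p \<in> Pts \<Longrightarrow> pcl p \<in> PC"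
    and card_lines: "X \<in> PC \<Longrightarrow> card {L \<in> LC. J X L} = q + 1"
    and card_classes: "L \<in> LC \<Longrightarrow> card {X \<in> PC. J X L} = q + 1"
    and class_join: "\<lbrakk>X \<in> PC; Y \<in> PC; X \<noteq> Y\<rbrakk> \<Longrightarrow> \<exists>!L. L \<in> LC \<and> J X L \<and> J Y L"
    and class_inc: "\<lbrakk>L \<in> LC; l \<in> Ln L; p \<in> Pts; I p l\<rbrakk> \<Longrightarrow> J (pcl p) L"
    and card_Ln: "\<lbrakk>L \<in> LC; p \<in> Pts; J (pcl p) L\<rbrakk> \<Longrightarrow> card {l \<in> Ln L. I p l} = q"
    and line_join: "\<lbrakk>L \<in> LC; p \<in> Pts; p' \<in> Pts; J (pcl p) L; J (pcl p') L; pcl p \<noteq> pcl p'\<rbrakk>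
      \<Longrightarrow> \<exists>!l. l \<in> Ln L \<and> I p l \<and> I p' l"
    and seg: "\<lbrakk>L \<in> LC; l \<in> Ln L; l' \<in> Ln L; p \<in> Pts; p' \<in> Pts; pcl p = pcl p';
      I p l; I p' l; I p l'\<rbrakk> \<Longrightarrow> I p' l'"
    and direction: "\<lbrakk>p \<in> Pts; p' \<in> Pts; pcl p = pcl p'; p \<noteq> p'\<rbrakk>
      \<Longrightarrow> \<exists>!L. L \<in> LC \<and> (\<exists>l\<in>Ln L. I p l \<and> I p' l)"
    and line_meet: "\<lbrakk>L \<in> LC; l \<in> Ln L; l' \<in> Ln L\<rbrakk> \<Longrightarrow> \<exists>p\<in>Pts. I p l \<and> I p l'"
    and line_class: "\<lbrakk>L \<in> LC; l \<in> Ln L; X \<in> PC; J X L\<rbrakk> \<Longrightarrow> \<exists>p\<in>Pts. pcl p = X \<and> I p l"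
    and no_fano: "\<lbrakk>odd q; a \<in> Pts; b \<in> Pts; c \<in> Pts; d \<in> Pts;
      pcl b = pcl a; pcl c = pcl a; pcl d = pcl a; c \<noteq> a;
      L \<in> LC; M \<in> LC; H \<in> LC; L \<noteq> M; M \<noteq> H;
      \<exists>l\<in>Ln L. I a l \<and> I b l; \<exists>l\<in>Ln L. I c l \<and> I d l;
      \<exists>l\<in>Ln M. I a l \<and> I c l; \<exists>l\<in>Ln M. I b l \<and> I d l;
      \<exists>l\<in>Ln H. I a l \<and> I d l; \<exists>l\<in>Ln H. I b l \<and> I c l\<rbrakk> \<Longrightarrow> False"
    and q_ge_5: "q \<ge> 5"
begin

section \<open>The factor plane, segments and pencils\<close>

lemma card_PC: "card PC = q^2 + q + 1"
proof -
  obtain X where X: "X \<in> PC" using PC_nonempty by blast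
  let ?T = "PC - {X}"
  have "(\<Sum>L\<in>{L \<in> LC. J X L}. card {Y \<in> ?T. J Y L}) = (\<Sum>Y\<in>?T. 1)"
  proof (rule sum_multicount_gen)
    show "\<forall>Y\<in>?T. card {L \<in> {L \<in> LC. J X L}. J Y L} = 1"
    proof
      fix Y assume "Y \<in> ?T"
      then have "card {L. L \<in> LC \<and> J X L \<and> J Y L} = 1"
        by (intro card_eq_1_if_Ex1 class_join[OF X]) auto
      then show "card {L \<in> {L \<in> LC. J X L}. J Y L} = 1" by (simp add: conj_assoc)
    qed
  qed (use finite_PC finite_LC in auto)
  moreover have "card {Y \<in> ?T. J Y L} = q" if "L \<in> {L \<in> LC. J X L}" for L
  proof -
    have "{Y \<in> ?T. J Y L} = {Y \<in> PC. J Y L} - {X}" by auto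
    then show ?thesis using that card_classes[of L] X finite_PC by simp
  qed
  ultimately have "(q + 1) * q = card ?T" using card_lines[OF X] by simp
  then have "card PC = (q + 1) * q + 1" using X finite_PC
    by (metis Suc_eq_plus1 card_Suc_Diff1)
  then show ?thesis by (simp add: power2_eq_square algebra_simps)
qed

lemma card_LC: "card LC = q^2 + q + 1"
proof -
  have "(\<Sum>L\<in>LC. card {X \<in> PC. J X L}) = (\<Sum>X\<in>PC. q + 1)"
    by (rule sum_multicount_gen) (use finite_PC finite_LC card_lines in auto)
  then have "card LC * (q + 1) = card PC * (q + 1)" using card_classes by simp
  then show ?thesis using card_PC by (metis add_gr_0 less_one mult_right_cancel not_gr_zero)
qed

text \<open>The blocks of this relation inside a point class on \<open>L\<close> are the segments of
  direction \<open>L\<close>, a parallel class of the affine plane. The witness line is irrelevant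
  because of \<open>seg\<close>: lines of \<open>Ln L\<close> that share a point agree on its whole
  class.\<close>

definition sim :: "'y \<Rightarrow> 'p \<Rightarrow> 'p \<Rightarrow> bool" where
  "sim L p p' \<longleftrightarrow> pcl p = pcl p' \<and> (\<exists>l\<in>Ln L. I p l \<and> I p' l)"

lemma sim_sym: "sim L p p' \<Longrightarrow> sim L p' p"
  unfolding sim_def by auto

lemma sim_refl:
  assumes "L \<in> LC" "p \<in> Pts" "J (pcl p) L"
  shows "sim L p p"
proof -
  have "{l \<in> Ln L. I p l} \<noteq> {}" using card_Ln[OF assms] q_ge_5 by (metis card.empty not_numeral_le_zero)
  then show ?thesis unfolding sim_def by auto
qed

lemma sim_line:
  "\<lbrakk>sim L p p'; L \<in> LC; p \<in> Pts; p' \<in> Pts; l \<in> Ln L; I p l\<rbrakk> \<Longrightarrow> I p' l"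
  unfolding sim_def using seg by blast

lemma sim_trans:
  "\<lbrakk>sim L p p'; sim L p' p''; L \<in> LC; p \<in> Pts; p' \<in> Pts; p'' \<in> Pts\<rbrakk> \<Longrightarrow> sim L p p''"
  unfolding sim_def by (metis seg)

lemma sim_inc: "\<lbrakk>sim L p p'; L \<in> LC; p \<in> Pts\<rbrakk> \<Longrightarrow> J (pcl p) L"
  unfolding sim_def using class_inc by metis

text \<open>The \<open>q\<close> lines of \<open>Ln L\<close> through \<open>Q\<close> and the class
  of \<open>Q\<close> itself act like the \<open>q + 1\<close> lines through a point of a projective
  plane. \<open>Q\<close> may lie inside or outside \<open>S\<close>; both cases occur
  below.\<close>

lemma pencil_count:
  assumes L: "L \<in> LC" and Q: "Q \<in> Pts" "J (pcl Q) L"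
    and S: "S \<subseteq> Pts" "\<And>p. p \<in> S \<Longrightarrow> J (pcl p) L"
  shows "(\<Sum>l\<in>{l \<in> Ln L. I Q l}. card {p \<in> S. I p l \<and> pcl p \<noteq> pcl Q})
      + card {p \<in> S. pcl p = pcl Q} = card S"
proof -
  have fS: "finite S" using S finite_Pts finite_subset by blast
  let ?T = "{p \<in> S. pcl p \<noteq> pcl Q}"
  have "(\<Sum>l\<in>{l \<in> Ln L. I Q l}. card {p \<in> ?T. I p l}) = (\<Sum>p\<in>?T. 1)"
  proof (rule sum_multicount_gen)
    show "\<forall>p\<in>?T. card {l \<in> {l \<in> Ln L. I Q l}. I p l} = 1"
    proof
      fix p assume p: "p \<in> ?T"
      then have "card {l. l \<in> Ln L \<and> I Q l \<and> I p l} = 1"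
        using S by (intro card_eq_1_if_Ex1 line_join[OF L Q(1) _ Q(2)]) auto
      then show "card {l \<in> {l \<in> Ln L. I Q l}. I p l} = 1" by (simp add: conj_assoc)
    qed
  qed (use fS finite_Ln in auto)
  moreover have "{p \<in> ?T. I p l} = {p \<in> S. I p l \<and> pcl p \<noteq> pcl Q}" for l by auto
  moreover have "card S = card ?T + card {p \<in> S. pcl p = pcl Q}"
  proof -
    have "S = ?T \<union> {p \<in> S. pcl p = pcl Q}" by auto
    moreover have "?T \<inter> {p \<in> S. pcl p = pcl Q} = {}" by auto
    ultimately show ?thesis using card_Un_disjoint fS
      by (metis (no_types, lifting) finite_Un)
  qed
  ultimately show ?thesis by simp
qed

section \<open>Arcs in a line class without excess\<close>

text \<open>The projective plane behind this has the segments of direction \<open>L\<close> as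
  points and the lines of \<open>Ln L\<close> together with the point classes on \<open>L\<close> as
  lines; the removed point is the one common to all point classes. A set of 2q + 2 points has
  exactly one bisecant through each of its points, so the q + 1 bisecants pair the points up.
  Counting modulo three at the outer points of one bisecant is then contradictory. That bisecant has
  to be a line of \<open>Ln L\<close>, since point classes do not meet in the punctured plane; if
  every bisecant is a point class, a separate argument is required.\<close>

lemma cap_exact:
  assumes L: "L \<in> LC"
    and S: "S \<subseteq> Pts" "\<And>p. p \<in> S \<Longrightarrow> J (pcl p) L"
    and nosim: "\<And>p p'. \<lbrakk>p \<in> S; p' \<in> S; sim L p p'\<rbrakk> \<Longrightarrow> p = p'"
    and line3: "\<And>l. l \<in> Ln L \<Longrightarrow> card {p \<in> S. I p l} \<le> 3"
    and class3: "\<And>X. card {p \<in> S. pcl p = X} \<le> 3"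
    and q3: "\<not> 3 dvd q" and card_S: "card S = 2 * q + 2"
  shows False
proof -
  define s where "s l = card {p \<in> S. I p l}" for l
  define c where "c X = card {p \<in> S. pcl p = X}" for X
  have fS: "finite S" using S finite_Pts finite_subset by blast
  define thr where "thr p = {l \<in> Ln L. I p l}" for p
  have fthr: "finite (thr p)" for p unfolding thr_def using finite_Ln by auto
  \<comment> \<open>If all q + 1 lines through \<open>p\<close> were trisecants, there would be 2(q
    + 1) further points; there are 2q + 1, so the total deficiency is exactly one.\<close>
  have pencil_S: "(\<Sum>l\<in>thr p. 3 - s l) + (3 - c (pcl p)) = 1" and s_pos: "\<And>l. l \<in> thr p \<Longrightarrow> s l > 0"
    and c_pos: "c (pcl p) > 0"
    if p: "p \<in> S" for p
  proof -
    have pP: "p \<in> Pts" "J (pcl p) L" using p S by auto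
    have 1: "(\<Sum>l\<in>thr p. card {p' \<in> S. I p' l \<and> pcl p' \<noteq> pcl p}) + c (pcl p) = 2 * q + 2"
      using pencil_count[OF L pP S] card_S unfolding thr_def c_def by simp
    have 2: "card {p' \<in> S. I p' l \<and> pcl p' \<noteq> pcl p} + 1 = s l" if l: "l \<in> thr p" for l
    proof -
      have "{p' \<in> S. I p' l} = insert p {p' \<in> S. I p' l \<and> pcl p' \<noteq> pcl p}"
        using l p nosim[OF p] unfolding thr_def sim_def by fastforce
      then show ?thesis unfolding s_def using fS by simp
    qed
    have 3: "s l \<le> 3" if "l \<in> thr p" for l using line3 that unfolding s_def thr_def by auto
    have 4: "c (pcl p) \<le> 3" using class3 unfolding c_def by auto
    have 5: "card {p' \<in> S. I p' l \<and> pcl p' \<noteq> pcl p} + (3 - s l) = 2" if "l \<in> thr p" for l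
      using 2[OF that] 3[OF that] by linarith
    have "(\<Sum>l\<in>thr p. card {p' \<in> S. I p' l \<and> pcl p' \<noteq> pcl p}) + (\<Sum>l\<in>thr p. 3 - s l) = (\<Sum>l\<in>thr p. 2)"
      unfolding sum.distrib[symmetric] by (rule sum.cong) (use 5 in auto)
    moreover have "(\<Sum>l\<in>thr p. 2) = 2 * q" using card_Ln[OF L pP] unfolding thr_def by simp
    ultimately show "(\<Sum>l\<in>thr p. 3 - s l) + (3 - c (pcl p)) = 1" using 1 4 by linarith
    show "\<And>l. l \<in> thr p \<Longrightarrow> s l > 0" using 2 by (metis add_gr_0 less_one)
    have "p \<in> {p' \<in> S. pcl p' = pcl p}" using p by auto
    then show "c (pcl p) > 0" unfolding c_def using fS card_gt_0_iff by fastforce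
  qed
  have s_le: "3 - s l \<le> 1" if "p \<in> S" "l \<in> thr p" for p l
  proof -
    have "3 - s l \<le> (\<Sum>l\<in>thr p. 3 - s l)" using that(2) fthr
      by (intro member_le_sum[of l "thr p" "\<lambda>l. 3 - s l"]) auto
    then show ?thesis using pencil_S[OF that(1)] by linarith
  qed
  have s_val: "s l \<in> {0, 2, 3}" if l: "l \<in> Ln L" for l
  proof (cases "s l = 0")
    case False
    then have "card {p \<in> S. I p l} \<noteq> 0" unfolding s_def by simp
    then have "{p \<in> S. I p l} \<noteq> {}" by (metis card.empty)
    then obtain p where "p \<in> S" "l \<in> thr p" using l unfolding thr_def by auto
    then show ?thesis using s_le[of p l] line3[OF l] unfolding s_def by auto
  qed simp
  have c_val: "c X \<in> {0, 2, 3}" for X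
  proof (cases "c X = 0")
    case False
    then have "card {p \<in> S. pcl p = X} \<noteq> 0" unfolding c_def by simp
    then have "{p \<in> S. pcl p = X} \<noteq> {}" by (metis card.empty)
    then obtain p where "p \<in> S" "pcl p = X" by auto
    then show ?thesis using pencil_S[of p] class3[of X] unfolding c_def by auto
  qed simp
  \<comment> \<open>\<open>B\<close> and \<open>CX\<close> are the two kinds of bisecants: lines of
    \<open>Ln L\<close> and point classes.\<close>
  define B where "B = {l \<in> Ln L. s l = 2}"
  define CX where "CX = {X \<in> PC. c X = 2}"
  have fB: "finite B" unfolding B_def using finite_Ln by auto
  have fCX: "finite CX" unfolding CX_def using finite_PC by auto
  have two: "card {l \<in> B. I p l} + of_bool (c (pcl p) = 2) = (1::nat)" if p: "p \<in> S" for p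
  proof -
    have "(\<Sum>l\<in>thr p. 3 - s l) = (\<Sum>l\<in>thr p. of_bool (s l = 2))"
    proof (rule sum.cong)
      fix l assume l: "l \<in> thr p"
      then have "s l \<in> {2, 3}" using s_val[of l] s_pos[OF p l] unfolding thr_def by auto
      then show "3 - s l = of_bool (s l = 2)" by auto
    qed simp
    also have "\<dots> = card {l \<in> thr p. s l = 2}" using fthr by (simp add: Int_def)
    also have "{l \<in> thr p. s l = 2} = {l \<in> B. I p l}" unfolding thr_def B_def by auto
    finally have 1: "(\<Sum>l\<in>thr p. 3 - s l) = card {l \<in> B. I p l}" .
    have "c (pcl p) \<in> {2,3}" using c_val[of "pcl p"] c_pos[OF p] by auto
    then have "3 - c (pcl p) = of_bool (c (pcl p) = 2)" by auto
    then show ?thesis using 1 pencil_S[OF p] by simp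
  qed
  have total: "card B + card CX = q + 1"
  proof -
    have "(\<Sum>p\<in>S. card {l \<in> B. I p l}) = (\<Sum>l\<in>B. 2)"
      by (rule sum_multicount_gen) (use fS fB in \<open>auto simp: B_def s_def\<close>)
    moreover have "(\<Sum>p\<in>S. card {X \<in> CX. pcl p = X}) = (\<Sum>X\<in>CX. 2)"
      by (rule sum_multicount_gen) (use fS fCX in \<open>auto simp: CX_def c_def\<close>)
    moreover have "card {X \<in> CX. pcl p = X} = of_bool (c (pcl p) = 2)" if "p \<in> S" for p
    proof -
      have "{X \<in> CX. pcl p = X} = (if c (pcl p) = 2 then {pcl p} else {})"
        using that pcl_in S unfolding CX_def by auto
      then show ?thesis by simp
    qed
    ultimately have "2 * card B + 2 * card CX
        = (\<Sum>p\<in>S. card {l \<in> B. I p l} + of_bool (c (pcl p) = 2))"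
      by (simp add: sum.distrib)
    also have "\<dots> = 2 * q + 2" using two card_S by simp
    finally show ?thesis by simp
  qed
  have pencil_Q: "(\<Sum>l\<in>thr Q. s l) + c (pcl Q) = 2 * q + 2"
    if Q: "Q \<in> Pts" "J (pcl Q) L" and out: "\<And>p. p \<in> S \<Longrightarrow> \<not> sim L Q p" for Q
  proof -
    have "{p \<in> S. I p l \<and> pcl p \<noteq> pcl Q} = {p \<in> S. I p l}" if "l \<in> thr Q" for l
      using that out unfolding thr_def sim_def by fastforce
    then have "(\<Sum>l\<in>thr Q. s l) = (\<Sum>l\<in>thr Q. card {p \<in> S. I p l \<and> pcl p \<noteq> pcl Q})"
      unfolding s_def by simp
    then show ?thesis
      using pencil_count[OF L Q S] card_S unfolding thr_def c_def by simp
  qed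
  show False
  proof (cases "B = {}")
    case True
    obtain p where p: "p \<in> S" using card_S by fastforce
    have pP: "p \<in> Pts" "J (pcl p) L" "pcl p \<in> PC" using p S pcl_in by auto
    have cp: "c (pcl p) = 2" using two[OF p] True by (auto simp: of_bool_def split: if_splits)
    have "card ({X \<in> PC. J X L} - {pcl p}) = q"
      using card_classes[OF L] pP finite_PC by simp
    then have "{X \<in> PC. J X L} - {pcl p} \<noteq> {}" using q_ge_5 by force
    then obtain Y where Y: "Y \<in> PC" "J Y L" "Y \<noteq> pcl p" by blast
    have "Ln L \<noteq> {}" using card_Ln[OF L pP(1,2)] q_ge_5 by fastforce
    then obtain l0 where "l0 \<in> Ln L" by auto
    then obtain R where R: "R \<in> Pts" "pcl R = Y" using line_class[OF L _ Y(1,2)] by auto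
    have RL: "J (pcl R) L" using R Y by simp
    let ?A = "{p' \<in> S. pcl p' = pcl p}"
    \<comment> \<open>The \<open>q\<close> lines through \<open>R\<close> meet the class of \<open>p\<close> in disjoint segments, and only two contain points of \<open>S\<close>.\<close>
    have "\<exists>l\<in>thr R. \<forall>p'\<in>?A. \<not> I p' l"
    proof (rule ccontr)
      assume "\<not> ?thesis"
      then have "\<forall>l\<in>thr R. \<exists>p'. p' \<in> ?A \<and> I p' l" by auto
      then obtain g where g: "\<And>l. l \<in> thr R \<Longrightarrow> g l \<in> ?A \<and> I (g l) l" by metis
      have "inj_on g (thr R)"
      proof (rule inj_onI)
        fix l m assume lm: "l \<in> thr R" "m \<in> thr R" "g l = g m"
        have "g l \<in> Pts" "J (pcl (g l)) L" "pcl R \<noteq> pcl (g l)"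
          using g[OF lm(1)] S(1) R Y pP by auto
        then have "\<exists>!k. k \<in> Ln L \<and> I R k \<and> I (g l) k" by (intro line_join[OF L R(1) _ RL])
        moreover have "l \<in> Ln L \<and> I R l \<and> I (g l) l" using g[OF lm(1)] lm(1) unfolding thr_def by simp
        moreover have "m \<in> Ln L \<and> I R m \<and> I (g l) m"
          using g[OF lm(2)] lm(2,3) unfolding thr_def by simp
        ultimately show "l = m" by blast
      qed
      then have "card (thr R) \<le> card ?A" using g fS
        by (intro card_inj_on_le[of g]) auto
      then show False using card_Ln[OF L R(1) RL] cp q_ge_5 unfolding c_def thr_def by simp
    qed
    then obtain l where l: "l \<in> thr R" "\<And>p'. p' \<in> ?A \<Longrightarrow> \<not> I p' l" by auto
    have lL: "l \<in> Ln L" using l unfolding thr_def by auto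
    obtain Q where Q: "Q \<in> Pts" "pcl Q = pcl p" "I Q l"
      using line_class[OF L lL pP(3,2)] by auto
    have "\<not> sim L Q p'" if "p' \<in> S" for p'
      using sim_line[OF _ L Q(1) _ lL Q(3), of p'] l(2)[of p'] that S Q(2) unfolding sim_def by auto
    \<comment> \<open>The class of \<open>Q\<close> accounts for two points of \<open>S\<close>; the
      other \<open>2 * q\<close> are covered by trisecants through \<open>Q\<close>, because no line
      of \<open>Ln L\<close> is a bisecant. Hence 3 would divide 2q.\<close>
    then have sm: "(\<Sum>l\<in>thr Q. s l) = 2 * q" using pencil_Q[of Q] Q pP cp by simp
    have "(\<Sum>l\<in>thr Q. s l) = 2 * card {l \<in> thr Q. s l = 2} + 3 * card {l \<in> thr Q. s l = 3}"
      by (rule sum_two_three) (use fthr s_val in \<open>auto simp: thr_def\<close>)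
    moreover have "{l \<in> thr Q. s l = 2} = {}" using True unfolding B_def thr_def by auto
    ultimately have "2 * 0 + 3 * card {l \<in> thr Q. s l = 3} = 2 * q" using sm by simp
    then show False using q3 mod_three_cancel_two by fastforce
  next
    case False
    then obtain l where l: "l \<in> B" by auto
    have lL: "l \<in> Ln L" "card {p \<in> S. I p l} = 2" using l unfolding B_def s_def by auto
    then obtain p1 p2 where p12: "{p \<in> S. I p l} = {p1, p2}" "p1 \<noteq> p2"
      by (metis card_2_iff)
    have p1: "p1 \<in> S" "I p1 l" and p2: "p2 \<in> S" "I p2 l" using p12 by auto
    have only_l: "{m \<in> B. I p m} = {l}" and cp: "c (pcl p) \<noteq> 2" if "p \<in> {p1, p2}" for p
    proof -
      have p: "p \<in> S" "I p l" using that p1 p2 by auto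
      then have "l \<in> {m \<in> B. I p m}" using l by auto
      then have "card {l} \<le> card {m \<in> B. I p m}" using fB by (intro card_mono) auto
      then have 1: "card {m \<in> B. I p m} = 1 \<and> c (pcl p) \<noteq> 2" using two[OF p(1)]
        by (auto simp: of_bool_def split: if_splits)
      then obtain m where "{m \<in> B. I p m} = {m}" using card_1_singletonE by blast
      then show "{m \<in> B. I p m} = {l}" using \<open>l \<in> {m \<in> B. I p m}\<close> by (metis singletonD)
      show "c (pcl p) \<noteq> 2" using 1 by simp
    qed
    have pcl12: "pcl p1 \<noteq> pcl p2" using nosim[OF p1(1) p2(1)] p1 p2 p12(2) lL unfolding sim_def by auto
    define Ys where "Ys = {Y \<in> PC. J Y L} - {pcl p1, pcl p2}"
    have fYs: "finite Ys" unfolding Ys_def using finite_PC by auto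
    have cYs: "card Ys = q - 1"
    proof -
      have "card {Y \<in> PC. J Y L} = q + 1" using card_classes[OF L] .
      moreover have "{pcl p1, pcl p2} \<subseteq> {Y \<in> PC. J Y L}" using p1 p2 S pcl_in by auto
      ultimately show ?thesis unfolding Ys_def using pcl12 by (simp add: card_Diff_subset)
    qed
    have "\<forall>Y\<in>Ys. \<exists>Q. Q \<in> Pts \<and> pcl Q = Y \<and> I Q l"
      using line_class[OF L lL(1)] unfolding Ys_def by auto
    then obtain Qf where Qf: "\<And>Y. Y \<in> Ys \<Longrightarrow> Qf Y \<in> Pts \<and> pcl (Qf Y) = Y \<and> I (Qf Y) l" by metis
    \<comment> \<open>The number of bisecants of either kind through the outer point
      \<open>Qf Y\<close> of \<open>l\<close>, apart from \<open>l\<close> itself. Omitting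
      \<open>l\<close> turns 2q + 2 into 2q, so the residue modulo three is that of
      \<open>q\<close>.\<close>
    define b where "b Y = card {m \<in> B - {l}. I (Qf Y) m} + of_bool (c Y = 2)" for Y
    have bmod: "b Y mod 3 = q mod 3" if Y: "Y \<in> Ys" for Y
    proof -
      let ?Q = "Qf Y"
      have Q: "?Q \<in> Pts" "pcl ?Q = Y" "I ?Q l" using Qf[OF Y] by auto
      have JQ: "J (pcl ?Q) L" using Q Y unfolding Ys_def by auto
      have "\<not> sim L ?Q p" if "p \<in> S" for p
      proof
        assume sm: "sim L ?Q p"
        then have "I p l" using sim_line[OF sm L Q(1) _ lL(1) Q(3)] that S by auto
        then have "p \<in> {p1, p2}" using that p12 by auto
        then show False using sm Q Y unfolding sim_def Ys_def by auto
      qed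
      from pencil_Q[OF Q(1) JQ this] have 1: "(\<Sum>l\<in>thr ?Q. s l) + c Y = 2 * q + 2" using Q by simp
      have 2: "(\<Sum>l\<in>thr ?Q. s l) = 2 * card {l \<in> thr ?Q. s l = 2} + 3 * card {l \<in> thr ?Q. s l = 3}"
        by (rule sum_two_three) (use fthr s_val in \<open>auto simp: thr_def\<close>)
      have "{m \<in> thr ?Q. s m = 2} = insert l {m \<in> B - {l}. I ?Q m}"
        using l Q(3) unfolding thr_def B_def by auto
      then have 3: "card {m \<in> thr ?Q. s m = 2} = card {m \<in> B - {l}. I ?Q m} + 1" using fB by simp
      obtain t :: nat where 4: "c Y = 2 * of_bool (c Y = 2) + 3 * t"
        using c_val[of Y] that by fastforce
      have arith: "\<lbrakk>u + w = 2 * q + 2; u = 2 * t2 + 3 * t3; t2 = m + 1; w = 2 * x + 3 * y\<rbrakk>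
        \<Longrightarrow> 2 * (m + x) + 3 * (t3 + y) = 2 * q" for u w t2 t3 m x y :: nat
        by simp
      have "2 * b Y + 3 * (card {l \<in> thr ?Q. s l = 3} + t) = 2 * q"
        unfolding b_def by (rule arith[OF 1 2 3 4])
      then show ?thesis by (rule mod_three_cancel_two)
    qed
    \<comment> \<open>Each of the \<open>q\<close> other bisecants meets \<open>l\<close> exactly
      once, and not in \<open>p1\<close> or \<open>p2\<close>, whose only bisecant is
      \<open>l\<close>.\<close>
    have bsum: "sum b Ys = q"
    proof -
      have "(\<Sum>Y\<in>Ys. card {m \<in> B - {l}. I (Qf Y) m}) = (\<Sum>m\<in>B - {l}. 1)"
      proof (rule sum_multicount_gen)
        show "\<forall>m\<in>B - {l}. card {Y \<in> Ys. I (Qf Y) m} = 1"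
        proof
          fix m assume m: "m \<in> B - {l}"
          then have mL: "m \<in> Ln L" unfolding B_def by auto
          obtain R where R: "R \<in> Pts" "I R l" "I R m" using line_meet[OF L lL(1) mL] by auto
          have JR: "J (pcl R) L" using class_inc[OF L lL(1) R(1,2)] .
          have ne: "pcl R \<noteq> pcl p" if p: "p \<in> {p1, p2}" for p
          proof
            assume "pcl R = pcl p"
            then have "I p m" using seg[OF L lL(1) mL R(1), of p] R p p1 p2 S by auto
            then show False using only_l[OF p] m by auto
          qed
          then have RY: "pcl R \<in> Ys" using JR R pcl_in unfolding Ys_def by auto
          have in_m: "I (Qf (pcl R)) m" using seg[OF L lL(1) mL R(1), of "Qf (pcl R)"] R Qf[OF RY] by auto
          have "Y = pcl R" if Y: "Y \<in> Ys" "I (Qf Y) m" for Y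
          proof (rule ccontr)
            assume ne: "Y \<noteq> pcl R"
            have "J (pcl (Qf Y)) L" using Qf[OF Y(1)] Y unfolding Ys_def by auto
            then have "\<exists>!k. k \<in> Ln L \<and> I (Qf Y) k \<and> I R k"
              using Qf[OF Y(1)] ne by (intro line_join[OF L _ R(1) _ JR]) auto
            then have "l = m"
              using Qf[OF Y(1)] R Y(2) lL(1) mL by blast
            then show False using m by simp
          qed
          then have "{Y \<in> Ys. I (Qf Y) m} = {pcl R}" using RY in_m by blast
          then show "card {Y \<in> Ys. I (Qf Y) m} = 1" by simp
        qed
      qed (use fYs fB in auto)
      moreover have "(\<Sum>Y\<in>Ys. of_bool (c Y = 2)) = card CX"
      proof -
        have "CX = {Y \<in> Ys. c Y = 2}"
        proof
          show "CX \<subseteq> {Y \<in> Ys. c Y = 2}"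
          proof
            fix X assume X: "X \<in> CX"
            then have "card {p \<in> S. pcl p = X} \<noteq> 0" unfolding CX_def c_def by simp
            then have "{p \<in> S. pcl p = X} \<noteq> {}" by (metis card.empty)
            then have "J X L" using S by auto
            then show "X \<in> {Y \<in> Ys. c Y = 2}" using X cp unfolding CX_def Ys_def by auto
          qed
        qed (auto simp: CX_def Ys_def)
        then show ?thesis using fYs by (simp add: Int_def)
      qed
      ultimately have "sum b Ys = card (B - {l}) + card CX" unfolding b_def by (simp add: sum.distrib)
      then show ?thesis using total l fB
        by (metis Suc_eq_plus1 add_Suc add_right_cancel card_Suc_Diff1)
    qed
    \<comment> \<open>The \<open>q - 1\<close> outer points carry numbers congruent to
      \<open>q\<close> with sum \<open>q\<close>. For residue 1 the sum is congruent to q - 1, hence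
      to 0; for residue 2 every number is at least 2, so the sum is at least 2(q - 1), more than
      \<open>q\<close>.\<close>
    have "q mod 3 = 1 \<or> q mod 3 = 2" using q3 by presburger
    then show False
    proof
      assume q1: "q mod 3 = 1"
      have "sum b Ys mod 3 = (\<Sum>Y\<in>Ys. b Y mod 3) mod 3" by (simp add: mod_sum_eq)
      also have "\<dots> = (q - 1) mod 3" using bmod q1 cYs by simp
      finally have "q mod 3 = (q - 1) mod 3" using bsum by simp
      moreover have "q - 1 = 3 * (q div 3)" using mult_div_mod_eq[of 3 q] q1 by linarith
      then have "(q - 1) mod 3 = 0" by simp
      ultimately show False using q1 by simp
    next
      assume q2: "q mod 3 = 2"
      have "card Ys * 2 \<le> sum b Ys"
        using sum_bounded_below[of Ys 2 b] bmod q2 by (metis mod_less_eq_dividend of_nat_id)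
      then show False using bsum cYs q_ge_5 by simp
    qed
  qed
qed

text \<open>All hypotheses pass to subsets, so a larger set may be cut down to exactly 2q + 2
  points.\<close>

lemma cap:
  assumes L: "L \<in> LC"
    and S: "S \<subseteq> Pts" "\<And>p. p \<in> S \<Longrightarrow> J (pcl p) L"
    and nosim: "\<And>p p'. \<lbrakk>p \<in> S; p' \<in> S; sim L p p'\<rbrakk> \<Longrightarrow> p = p'"
    and line3: "\<And>l. l \<in> Ln L \<Longrightarrow> card {p \<in> S. I p l} \<le> 3"
    and class3: "\<And>X. card {p \<in> S. pcl p = X} \<le> 3"
    and q3: "\<not> 3 dvd q"
  shows "card S \<le> 2 * q + 1"
proof (rule ccontr)
  assume "\<not> ?thesis"
  then obtain T where T: "T \<subseteq> S" "card T = 2 * q + 2" "finite T"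
    by (metis Suc_eq_plus1 add_2_eq_Suc' not_less_eq_eq obtain_subset_with_card_n)
  have fS: "finite S" using S finite_Pts finite_subset by blast
  have mono: "card {p \<in> T. P p} \<le> card {p \<in> S. P p}" for P
    using T fS by (intro card_mono) auto
  show False
  proof (rule cap_exact[OF L, of T])
    show "p = p'" if "p \<in> T" "p' \<in> T" "sim L p p'" for p p'
      using nosim[of p p'] that T(1) by auto
    show "card {p \<in> T. I p l} \<le> 3" if "l \<in> Ln L" for l
      using mono[of "\<lambda>p. I p l"] line3[OF that] by linarith
    show "card {p \<in> T. pcl p = X} \<le> 3" for X
      using mono[of "\<lambda>p. pcl p = X"] class3[of X] by linarith
  qed (use T S q3 in auto)
qed

end

section \<open>Arcs with at most three points on a line\<close>

locale hjelmslev_arc = hjelmslev +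
  fixes K :: "'a set"
  assumes K_Pts: "K \<subseteq> Pts"
    and arc: "\<lbrakk>L \<in> LC; l \<in> Ln L\<rbrakk> \<Longrightarrow> card {p \<in> K. I p l} \<le> 3"
begin

section \<open>Weights and excess of point classes\<close>

lemma finite_K: "finite K"
  using K_Pts finite_Pts finite_subset by blast

definition cl :: "'b \<Rightarrow> 'a set" where "cl X = {p \<in> K. pcl p = X}"

definition w :: "'b \<Rightarrow> nat" where "w X = card (cl X)"

definition W :: "'c \<Rightarrow> nat" where "W L = card {p \<in> K. J (pcl p) L}"

definition sg :: "'c \<Rightarrow> 'a \<Rightarrow> nat" where "sg L p = card {p' \<in> K. sim L p p'}"

text \<open>The largest weight of a segment of the class \<open>X\<close> in the direction \<open>L\<close>, minus one
  (and \<open>0\<close> for classes without arc points).\<close>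

definition e :: "'c \<Rightarrow> 'b \<Rightarrow> nat" where
  "e L X = Max (insert 0 ((\<lambda>p. sg L p - 1) ` cl X))"

definition D :: "'b \<Rightarrow> nat" where "D X = (\<Sum>L\<in>{L \<in> LC. J X L}. e L X)"

lemma finite_cl: "finite (cl X)"
  unfolding cl_def using finite_K by auto

lemma cl_Pts: "p \<in> cl X \<Longrightarrow> p \<in> Pts"
  unfolding cl_def using K_Pts by auto

lemma e_ge: "p \<in> cl X \<Longrightarrow> sg L p - 1 \<le> e L X"
  unfolding e_def using finite_cl by (intro Max_ge) auto

lemma e_attained:
  assumes "e L X \<noteq> 0"
  obtains p where "p \<in> cl X" "e L X = sg L p - 1"
proof -
  have "e L X \<in> insert 0 ((\<lambda>p. sg L p - 1) ` cl X)"
    unfolding e_def using finite_cl by (intro Max_in) auto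
  then show ?thesis using assms that by auto
qed

lemma sg_pos:
  assumes "p \<in> cl X" "L \<in> LC" "J X L"
  shows "sg L p \<ge> 1"
proof -
  have "p \<in> {p' \<in> K. sim L p p'}"
    using assms sim_refl[OF assms(2) cl_Pts[OF assms(1)]] unfolding cl_def by auto
  then have "card {p} \<le> sg L p" unfolding sg_def using finite_K by (intro card_mono) auto
  then show ?thesis by simp
qed

lemma sg_le_3:
  assumes "p \<in> cl X" "L \<in> LC" "J X L"
  shows "sg L p \<le> 3"
proof -
  have pP: "p \<in> Pts" "pcl p = X" using cl_Pts assms unfolding cl_def by auto
  obtain l where l: "l \<in> Ln L" "I p l" using sim_refl[OF assms(2) pP(1)] pP assms unfolding sim_def by auto
  have "{p' \<in> K. sim L p p'} \<subseteq> {p' \<in> K. I p' l}"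
    using sim_line[OF _ assms(2) pP(1) _ l] K_Pts by auto
  then have "sg L p \<le> card {p' \<in> K. I p' l}" unfolding sg_def using finite_K by (intro card_mono) auto
  then show ?thesis using arc[OF assms(2) l(1)] by linarith
qed

lemma e_le_2:
  assumes "L \<in> LC" "J X L"
  shows "e L X \<le> 2"
proof (cases "e L X = 0")
  case False
  then obtain p where "p \<in> cl X" "e L X = sg L p - 1" by (rule e_attained)
  then show ?thesis using sg_le_3[of p X L] assms by simp
qed simp

text \<open>The \<open>q\<close> lines of class \<open>L\<close> through \<open>p\<close> cover all other classes on \<open>L\<close>, and each of them
  contains the segment of \<open>p\<close>.\<close>

lemma segment_bound:
  assumes p: "p \<in> cl X" and L: "L \<in> LC" "J X L"
  shows "W L + q * sg L p \<le> w X + 3 * q"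
proof -
  have pP: "p \<in> Pts" "pcl p = X" using cl_Pts p unfolding cl_def by auto
  let ?S = "{p' \<in> K. J (pcl p') L}"
  let ?T = "{l \<in> Ln L. I p l}"
  have cT: "card ?T = q" using card_Ln[OF L(1) pP(1)] pP L by simp
  have 1: "(\<Sum>l\<in>?T. card {p' \<in> ?S. I p' l \<and> pcl p' \<noteq> X}) + card {p' \<in> ?S. pcl p' = X} = W L"
    unfolding W_def using pencil_count[OF L(1) pP(1), of ?S] pP L K_Pts by fastforce
  have 2: "{p' \<in> ?S. pcl p' = X} = cl X" unfolding cl_def using L by auto
  have 3: "card {p' \<in> ?S. I p' l \<and> pcl p' \<noteq> X} + sg L p \<le> 3" if l: "l \<in> ?T" for l
  proof -
    let ?A = "{p' \<in> ?S. I p' l \<and> pcl p' \<noteq> X}" and ?B = "{p' \<in> K. sim L p p'}"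
    have "?A \<inter> ?B = {}" using pP unfolding sim_def by auto
    then have "card ?A + card ?B = card (?A \<union> ?B)" using finite_K by (simp add: card_Un_disjoint)
    also have "\<dots> \<le> card {p' \<in> K. I p' l}"
      using sim_line[OF _ L(1) pP(1), of _ l] l K_Pts finite_K by (intro card_mono) auto
    also have "\<dots> \<le> 3" using arc[OF L(1)] l by simp
    finally show ?thesis unfolding sg_def .
  qed
  have "(\<Sum>l\<in>?T. card {p' \<in> ?S. I p' l \<and> pcl p' \<noteq> X} + sg L p) \<le> (\<Sum>l\<in>?T. 3)"
    by (rule sum_mono) (rule 3)
  then have "(\<Sum>l\<in>?T. card {p' \<in> ?S. I p' l \<and> pcl p' \<noteq> X}) + q * sg L p \<le> 3 * q"
    using cT by (simp add: sum.distrib)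
  then show ?thesis using 1 2 unfolding w_def by simp
qed

text \<open>This is \<open>segment_bound\<close> for a heaviest segment, whose weight is
  \<open>e L X + 1\<close>. The class must be nonempty: with \<open>e L X = 0\<close> the bound
  still relies on a segment of weight one.\<close>

lemma excess_bound:
  assumes X: "cl X \<noteq> {}" and L: "L \<in> LC" "J X L"
  shows "W L + q * e L X \<le> w X + 2 * q"
proof (cases "e L X = 0")
  case True
  obtain p where p: "p \<in> cl X" using X by auto
  have "q * 1 \<le> q * sg L p" using sg_pos[OF p L] by (intro mult_le_mono2)
  then show ?thesis using segment_bound[OF p L] True unfolding True by linarith
next
  case False
  then obtain p where p: "p \<in> cl X" "e L X = sg L p - 1" by (rule e_attained)
  then have "sg L p = e L X + 1" using sg_pos[OF p(1) L] by simp
  then show ?thesis using segment_bound[OF p(1) L] by (simp add: algebra_simps)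
qed

lemma W_pencil_sum:
  assumes X: "X \<in> PC"
  shows "(\<Sum>L\<in>{L \<in> LC. J X L}. W L) = card K + q * w X"
proof -
  have "(\<Sum>L\<in>{L \<in> LC. J X L}. W L) = (\<Sum>p\<in>K. if pcl p = X then q + 1 else 1)"
    unfolding W_def
  proof (rule sum_multicount_gen)
    show "\<forall>p\<in>K. card {L \<in> {L \<in> LC. J X L}. J (pcl p) L} = (if pcl p = X then q + 1 else 1)"
    proof
      fix p assume p: "p \<in> K"
      have *: "{L \<in> {L \<in> LC. J X L}. J (pcl p) L} = {L. L \<in> LC \<and> J X L \<and> J (pcl p) L}" by auto
      show "card {L \<in> {L \<in> LC. J X L}. J (pcl p) L} = (if pcl p = X then q + 1 else 1)"
      proof (cases "pcl p = X")
        case True then show ?thesis unfolding * using card_lines[OF X] by simp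
      next
        case False
        then have "card {L. L \<in> LC \<and> J X L \<and> J (pcl p) L} = 1"
          using p K_Pts pcl_in by (intro card_eq_1_if_Ex1 class_join[OF X]) auto
        then show ?thesis unfolding * using False by simp
      qed
    qed
  qed (use finite_K finite_LC in auto)
  also have "\<dots> = (\<Sum>p\<in>K. 1 + q * of_bool (pcl p = X))" by (intro sum.cong) auto
  also have "\<dots> = card K + q * w X"
    unfolding sum.distrib sum_distrib_left[symmetric] w_def cl_def
    using finite_K by (simp add: Int_def)
  finally show ?thesis .
qed

text \<open>Summing \<open>excess_bound\<close> over the pencil of \<open>X\<close> counts the
  points of \<open>X\<close> itself \<open>q + 1\<close> times, which cancels the term
  \<open>q * w X\<close>.\<close>

lemma pencil_bound:
  assumes X: "X \<in> PC" "cl X \<noteq> {}"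
  shows "card K + q * D X \<le> w X + 2 * q * (q + 1)"
proof -
  have "(\<Sum>L\<in>{L \<in> LC. J X L}. W L + q * e L X) \<le> (\<Sum>L\<in>{L \<in> LC. J X L}. w X + 2 * q)"
    by (rule sum_mono) (use excess_bound[OF X(2)] in auto)
  also have "\<dots> = (q + 1) * (w X + 2 * q)" using card_lines[OF X(1)] by simp
  finally have "card K + q * w X + q * D X \<le> (q + 1) * (w X + 2 * q)"
    unfolding sum.distrib W_pencil_sum[OF X(1)] sum_distrib_left[symmetric] D_def[symmetric] .
  then show ?thesis by (simp add: algebra_simps)
qed

text \<open>Seen from \<open>p\<close>, each other arc point of the class lies in exactly one
  direction.\<close>

lemma sg_sum:
  assumes p: "p \<in> cl X" and X: "X \<in> PC"
  shows "(\<Sum>L\<in>{L \<in> LC. J X L}. sg L p - 1) = w X - 1"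
proof -
  have pP: "p \<in> Pts" "pcl p = X" using cl_Pts p unfolding cl_def by auto
  have "(\<Sum>L\<in>{L \<in> LC. J X L}. card {p' \<in> cl X - {p}. sim L p p'}) = (\<Sum>p'\<in>cl X - {p}. 1)"
  proof (rule sum_multicount_gen)
    show "\<forall>p'\<in>cl X - {p}. card {L \<in> {L \<in> LC. J X L}. sim L p p'} = 1"
    proof
      fix p' assume p': "p' \<in> cl X - {p}"
      have p'P: "p' \<in> Pts" "pcl p' = X" using p' cl_Pts unfolding cl_def by auto
      have "\<exists>!L. L \<in> LC \<and> (\<exists>l\<in>Ln L. I p l \<and> I p' l)"
        using pP p'P p' by (intro direction) auto
      then have "card {L. L \<in> LC \<and> (\<exists>l\<in>Ln L. I p l \<and> I p' l)} = 1" by (rule card_eq_1_if_Ex1)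
      moreover have "{L. L \<in> LC \<and> (\<exists>l\<in>Ln L. I p l \<and> I p' l)} = {L \<in> {L \<in> LC. J X L}. sim L p p'}"
        using pP(2) p'P(2) class_inc[OF _ _ pP(1)] unfolding sim_def by fastforce
      ultimately show "card {L \<in> {L \<in> LC. J X L}. sim L p p'} = 1" by simp
    qed
  qed (use finite_cl finite_LC in auto)
  moreover have "card {p' \<in> cl X - {p}. sim L p p'} = sg L p - 1" if "L \<in> {L \<in> LC. J X L}" for L
  proof -
    have "{p' \<in> cl X - {p}. sim L p p'} = {p' \<in> K. sim L p p'} - {p}"
      using pP unfolding cl_def sim_def by auto
    moreover have "p \<in> {p' \<in> K. sim L p p'}"
      using p pP that sim_refl[of L p] unfolding cl_def by auto
    ultimately show ?thesis unfolding sg_def using finite_K by simp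
  qed
  ultimately show ?thesis unfolding w_def using p finite_cl by simp
qed

section \<open>Directions determined inside a point class\<close>

lemma D_ge:
  assumes "X \<in> PC"
  shows "w X - 1 \<le> D X"
proof (cases "cl X = {}")
  case True then show ?thesis unfolding w_def by simp
next
  case False
  then obtain p where p: "p \<in> cl X" by auto
  show ?thesis unfolding sg_sum[OF p assms, symmetric] D_def
    by (rule sum_mono) (rule e_ge[OF p])
qed

text \<open>A point \<open>r\<close> of the class off the triple segment sees at least three points
  outside its own segment of direction \<open>L\<close>, namely those of the triple. These
  contribute at least three in directions other than \<open>L\<close>, and \<open>L\<close>
  contributes two.\<close>

lemma D_ge_5_if_triple:
  assumes X: "X \<in> PC" and w4: "w X \<ge> 4" and L: "L \<in> LC" "J X L" and e2: "e L X = 2"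
  shows "D X \<ge> 5"
proof -
  have "e L X \<noteq> 0" using e2 by simp
  then obtain p where p: "p \<in> cl X" "e L X = sg L p - 1" by (rule e_attained)
  then have sg3: "sg L p = 3" using e2 sg_le_3[OF p(1) L] by simp
  have sub: "{p' \<in> K. sim L p p'} \<subseteq> cl X" using p unfolding cl_def sim_def by auto
  have "{p' \<in> K. sim L p p'} \<noteq> cl X" using sg3 w4 unfolding sg_def w_def by auto
  then obtain r where r: "r \<in> cl X" "\<not> sim L p r" using sub unfolding cl_def by auto
  have P: "p \<in> Pts" "r \<in> Pts" using p r cl_Pts by auto
  have disj: "{p' \<in> K. sim L p p'} \<inter> {p' \<in> K. sim L r p'} = {}"
  proof (rule ccontr)
    assume "\<not> ?thesis"
    then obtain p' where "p' \<in> K" "sim L p p'" "sim L r p'" by auto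
    then have "sim L p r" using sim_trans[of L p p' r] sim_sym[of L r p'] P L K_Pts by auto
    then show False using r by simp
  qed
  have "sg L p + sg L r = card ({p' \<in> K. sim L p p'} \<union> {p' \<in> K. sim L r p'})"
    unfolding sg_def using disj finite_K by (simp add: card_Un_disjoint)
  also have "\<dots> \<le> w X" unfolding w_def using sub r finite_cl
    by (intro card_mono) (auto simp: cl_def sim_def)
  finally have sgr: "sg L r + 3 \<le> w X" using sg3 by simp
  let ?A = "{L \<in> LC. J X L}"
  have fA: "finite ?A" using finite_LC by simp
  have LA: "L \<in> ?A" using L by simp
  have "w X - 1 = (sg L r - 1) + (\<Sum>M\<in>?A - {L}. sg M r - 1)"
    using sg_sum[OF r(1) X] sum.remove[OF fA LA, of "\<lambda>M. sg M r - 1"] by simp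
  also have "(\<Sum>M\<in>?A - {L}. sg M r - 1) \<le> (\<Sum>M\<in>?A - {L}. e M X)"
    by (rule sum_mono) (rule e_ge[OF r(1)])
  also have "D X = 2 + (\<Sum>M\<in>?A - {L}. e M X)"
    unfolding D_def using sum.remove[OF fA LA, of "\<lambda>M. e M X"] e2 by simp
  ultimately show ?thesis using sgr w4 sg_pos[OF r(1) L] by linarith
qed

lemma sg_classes_even:
  assumes L: "L \<in> LC" "J X L" and two: "\<And>p. p \<in> A \<Longrightarrow> sg L p = 2"
    and A: "A \<subseteq> cl X" and closed: "\<And>p p'. \<lbrakk>p \<in> A; p' \<in> cl X; sim L p p'\<rbrakk> \<Longrightarrow> p' \<in> A"
  shows "even (card A)"
proof -
  define C where "C = (\<lambda>p. {p' \<in> K. sim L p p'}) ` A"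
  have fA: "finite A" using A finite_cl finite_subset by blast
  have AP: "p \<in> Pts" "p \<in> K" "pcl p = X" if "p \<in> A" for p
    using that A cl_Pts unfolding cl_def by auto
  have sub: "{p' \<in> K. sim L p p'} \<subseteq> A" if "p \<in> A" for p
  proof
    fix r assume r: "r \<in> {p' \<in> K. sim L p p'}"
    then have "r \<in> cl X" using AP[OF that] unfolding cl_def sim_def by auto
    then show "r \<in> A" using closed[OF that, of r] r by blast
  qed
  have UC: "\<Union>C = A"
  proof
    show "\<Union>C \<subseteq> A" unfolding C_def using sub by blast
    show "A \<subseteq> \<Union>C" unfolding C_def using sim_refl[OF L(1)] AP L(2) by auto
  qed
  have "2 * card C = card (\<Union>C)"
  proof (rule card_partition)
    show "finite C" unfolding C_def using fA by simp
    show "finite (\<Union>C)" using UC fA by simp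
    show "card c = 2" if "c \<in> C" for c using that two unfolding C_def sg_def by auto
    show "c1 \<inter> c2 = {}" if c: "c1 \<in> C" "c2 \<in> C" "c1 \<noteq> c2" for c1 c2
    proof (rule ccontr)
      assume "c1 \<inter> c2 \<noteq> {}"
      then obtain r where r: "r \<in> c1" "r \<in> c2" by auto
      obtain a b where ab: "a \<in> A" "b \<in> A" "c1 = {p' \<in> K. sim L a p'}" "c2 = {p' \<in> K. sim L b p'}"
        using c unfolding C_def by auto
      have rA: "r \<in> Pts" using r ab K_Pts by auto
      have "sim L a r" "sim L b r" using r ab by auto
      then have "sim L a b" using sim_trans[OF _ sim_sym L(1)] AP ab rA by blast
      have "c1 = c2" unfolding ab(3,4)
        using sim_trans[OF \<open>sim L a b\<close> _ L(1)] sim_trans[OF sim_sym[OF \<open>sim L a b\<close>] _ L(1)]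
          AP(1)[OF ab(1)] AP(1)[OF ab(2)] K_Pts by blast
      then show False using c by simp
    qed
  qed
  then show ?thesis using UC by (metis dvd_triv_left)
qed

text \<open>Without triples each direction is a matching on the arc points of \<open>X\<close>, and
  a matching on an odd set misses a point. This is the argument that an edge colouring of the
  complete graph on an odd number w \<ge> 3 of vertices needs w colours.\<close>

lemma D_ge_if_odd:
  assumes X: "X \<in> PC" and odd: "odd (w X)" and w2: "w X \<ge> 2"
    and no_triple: "\<And>L. \<lbrakk>L \<in> LC; J X L\<rbrakk> \<Longrightarrow> e L X \<le> 1"
  shows "w X \<le> D X"
proof -
  let ?A = "{L \<in> LC. J X L}"
  have "(\<Sum>p\<in>cl X. sg L p - 1) \<le> (w X - 1) * e L X" if L: "L \<in> ?A" for L
  proof -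
    let ?B = "{p \<in> cl X. sg L p = 2}"
    have LL: "L \<in> LC" "J X L" using L by auto
    have ev: "even (card ?B)"
    proof (rule sg_classes_even[OF LL])
      fix p p' assume p: "p \<in> ?B" "p' \<in> cl X" "sim L p p'"
      have P: "p \<in> Pts" "p' \<in> Pts" using p cl_Pts by auto
      have "{r \<in> K. sim L p r} = {r \<in> K. sim L p' r}"
        using sim_trans[OF p(3) _ LL(1)] sim_trans[OF sim_sym[OF p(3)] _ LL(1)] P K_Pts by blast
      then show "p' \<in> ?B" using p unfolding sg_def by auto
    qed auto
    have sg01: "sg L p - 1 = of_bool (sg L p = 2)" if "p \<in> cl X" for p
      using e_ge[OF that, of L] no_triple[OF LL] sg_pos[OF that LL]
      by (cases "sg L p = 2") auto
    have "(\<Sum>p\<in>cl X. sg L p - 1) = (\<Sum>p\<in>cl X. of_bool (sg L p = 2))"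
      by (rule sum.cong) (use sg01 in auto)
    also have "\<dots> = card ?B" using finite_cl by (simp add: Int_def)
    finally have 1: "(\<Sum>p\<in>cl X. sg L p - 1) = card ?B" .
    show ?thesis
    proof (cases "?B = {}")
      case True
      show ?thesis unfolding 1 True by simp
    next
      case False
      then obtain p where p: "p \<in> cl X" "sg L p = 2" by auto
      then have e1: "e L X \<ge> 1" using e_ge[OF p(1), of L] by simp
      have "card ?B \<le> w X" unfolding w_def using finite_cl by (intro card_mono) auto
      moreover have "card ?B \<noteq> w X" using ev odd by metis
      ultimately have "card ?B \<le> (w X - 1) * 1" by simp
      also have "\<dots> \<le> (w X - 1) * e L X" using e1 by (intro mult_le_mono2)
      finally show ?thesis using 1 by simp
    qed
  qed
  then have "(\<Sum>L\<in>?A. \<Sum>p\<in>cl X. sg L p - 1) \<le> (\<Sum>L\<in>?A. (w X - 1) * e L X)"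
    by (rule sum_mono)
  moreover have "(\<Sum>L\<in>?A. \<Sum>p\<in>cl X. sg L p - 1) = (\<Sum>p\<in>cl X. w X - 1)"
    unfolding sum.swap[of _ _ ?A] using sg_sum[OF _ X] by (intro sum.cong) auto
  ultimately have "w X * (w X - 1) \<le> (w X - 1) * D X"
    unfolding D_def sum_distrib_left w_def by simp
  then show ?thesis using w2 by simp
qed

text \<open>Four points with no three collinear and only three directions between them form a
  parallelogram with parallel diagonals.\<close>

lemma D_ge_4_if_odd_q:
  assumes X: "X \<in> PC" and w4: "w X = 4" and odd: "odd q"
  shows "D X \<ge> 4"
proof (rule ccontr)
  assume "\<not> D X \<ge> 4"
  then have D3: "D X = 3" using D_ge[OF X] w4 by simp
  let ?A = "{L \<in> LC. J X L}"
  have fA: "finite ?A" using finite_LC by simp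
  have no_triple: "e L X \<le> 1" if "L \<in> ?A" for L
    using D_ge_5_if_triple[OF X] that w4 D3 e_le_2[of L X] by fastforce
  \<comment> \<open>\<open>D X = w X - 1\<close> leaves no slack: every point attains the maximum in
    every direction, so the three active directions are perfect matchings of the four
    points.\<close>
  have sg_e: "sg L p - 1 = e L X" if p: "p \<in> cl X" and L: "L \<in> ?A" for p L
  proof (rule ccontr)
    assume "\<not> ?thesis"
    then have lt: "sg L p - 1 < e L X" using e_ge[OF p, of L] by simp
    have "(\<Sum>M\<in>?A. sg M p - 1) < (\<Sum>M\<in>?A. e M X)"
      by (rule sum_strict_mono_ex1[OF fA]) (use e_ge[OF p] lt L in auto)
    then show False using sg_sum[OF p X] D3 w4 unfolding D_def by simp
  qed
  have partner: "\<exists>!r. r \<in> cl X \<and> r \<noteq> p \<and> sim L p r"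
    if L: "L \<in> ?A" "e L X = 1" and p: "p \<in> cl X" for L p
  proof -
    have "sg L p = 2" using sg_e[OF p L(1)] L(2) sg_pos[OF p] L(1) by simp
    moreover have pin: "p \<in> {p' \<in> K. sim L p p'}"
      using p L cl_Pts sim_refl[of L p] unfolding cl_def by auto
    ultimately have "card ({p' \<in> K. sim L p p'} - {p}) = 1" unfolding sg_def using finite_K by simp
    then obtain r where r: "{p' \<in> K. sim L p p'} - {p} = {r}" using card_1_singletonE by blast
    have *: "(r' \<in> cl X \<and> r' \<noteq> p \<and> sim L p r') \<longleftrightarrow> r' \<in> {p' \<in> K. sim L p p'} - {p}" for r'
      using p unfolding cl_def sim_def by auto
    show ?thesis unfolding * r by simp
  qed
  have "card (cl X) = 4" using w4 unfolding w_def .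
  then obtain a b c d where abcd: "cl X = {a, b, c, d}"
    and ne: "a \<noteq> b" "a \<noteq> c" "a \<noteq> d" "b \<noteq> c" "b \<noteq> d" "c \<noteq> d"
    by (auto simp: card_Suc_eq numeral_eq_Suc)
  have inX: "a \<in> cl X" "b \<in> cl X" "c \<in> cl X" "d \<in> cl X" using abcd by auto
  have dir: "\<exists>L\<in>?A. e L X = 1 \<and> sim L a r" if r: "r \<in> cl X" "r \<noteq> a" for r
  proof -
    have P: "a \<in> Pts" "r \<in> Pts" "pcl a = pcl r" "pcl a = X" using inX r cl_Pts unfolding cl_def by auto
    obtain L where L: "L \<in> LC" "\<exists>l\<in>Ln L. I a l \<and> I r l" using direction[OF P(1,2,3)] r by blast
    then have s: "sim L a r" using P unfolding sim_def by auto
    have LA: "L \<in> ?A" using sim_inc[OF s L(1) P(1)] P L by simp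
    have "{a, r} \<subseteq> {p' \<in> K. sim L a p'}"
      using s r inX sim_refl[of L a] P LA unfolding cl_def by auto
    then have "card {a, r} \<le> sg L a" unfolding sg_def using finite_K by (intro card_mono) auto
    then have "sg L a \<ge> 2" using r by simp
    then have "e L X = 1" using e_ge[OF inX(1), of L] no_triple[OF LA] by simp
    then show ?thesis using LA s by auto
  qed
  \<comment> \<open>A perfect matching of four points that contains one pair also contains the
    complementary pair.\<close>
  have opposite: "sim L t u"
    if L: "L \<in> ?A" "e L X = 1" "sim L a s" and eq: "cl X = {a, s, t, u}" and d: "a \<noteq> s" "t \<noteq> a" "t \<noteq> s" for L s t u
  proof -
    have st: "s \<in> cl X" "t \<in> cl X" using eq by auto
    obtain r where r: "r \<in> cl X" "r \<noteq> t" "sim L t r" using partner[OF L(1,2) st(2)] by blast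
    have P: "a \<in> Pts" "s \<in> Pts" "t \<in> Pts" using inX st cl_Pts by auto
    have "r \<noteq> a"
    proof
      assume "r = a"
      then have "sim L a t" using r sim_sym by blast
      then show False using partner[OF L(1,2) inX(1)] L(3) st d by metis
    qed
    moreover have "r \<noteq> s"
    proof
      assume "r = s"
      then have "sim L s t" using r sim_sym by blast
      then show False using partner[OF L(1,2) st(1)] sim_sym[OF L(3)] inX(1) st d by metis
    qed
    ultimately have "r = u" using r eq by auto
    then show ?thesis using r by simp
  qed
  obtain L where L: "L \<in> ?A" "e L X = 1" "sim L a b" using dir[of b] inX ne by auto
  obtain M where M: "M \<in> ?A" "e M X = 1" "sim M a c" using dir[of c] inX ne by auto
  obtain H where H: "H \<in> ?A" "e H X = 1" "sim H a d" using dir[of d] inX ne by auto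
  have opp: "sim L c d" "sim M b d" "sim H b c"
    using opposite[OF L, of c d] opposite[OF M, of b d] opposite[OF H, of b c] abcd ne by auto
  have LMH: "L \<noteq> M" "M \<noteq> H"
    using partner[OF L(1,2) inX(1)] partner[OF M(1,2) inX(1)] L(3) H(3) M(3) inX ne by metis+
  have P: "a \<in> Pts" "b \<in> Pts" "c \<in> Pts" "d \<in> Pts" using inX cl_Pts by auto
  have eq: "pcl b = pcl a" "pcl c = pcl a" "pcl d = pcl a" using inX unfolding cl_def by auto
  have lines: "\<exists>l\<in>Ln L. I a l \<and> I b l" "\<exists>l\<in>Ln L. I c l \<and> I d l"
      "\<exists>l\<in>Ln M. I a l \<and> I c l" "\<exists>l\<in>Ln M. I b l \<and> I d l"
      "\<exists>l\<in>Ln H. I a l \<and> I d l" "\<exists>l\<in>Ln H. I b l \<and> I c l"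
    using L(3) M(3) H(3) opp unfolding sim_def by blast+
  have LC: "L \<in> LC" "M \<in> LC" "H \<in> LC" using L M H by auto
  show False
    by (rule no_fano[OF odd P eq ne(2)[symmetric] LC LMH lines])
qed

text \<open>Only w = 4 can be tight. Weight 5 has D \<ge> 5, by a triple or by oddness, and gives
  2q^2 - 3q + 5; from weight 6 on the trivial D \<ge> w - 1 suffices, because each further point
  costs q and gains one.\<close>

lemma bound_if_heavy_class:
  assumes X: "X \<in> PC" and w4: "w X \<ge> 4"
  shows "card K \<le> (if odd q then 2 * q^2 - 2 * q + 4 else 2 * q^2 - q + 4)"
proof -
  have "cl X \<noteq> {}" using w4 unfolding w_def by auto
  from pencil_bound[OF X this] have 1: "card K + q * D X \<le> w X + 2 * q * (q + 1)" .
  have q2: "2 * q \<le> 2 * q^2" by (simp add: power2_eq_square)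
  have dcase: "D X \<ge> 4 \<and> w X = 4 \<or> \<not> odd q \<and> D X \<ge> 3 \<and> w X = 4 \<or> D X \<ge> 5 \<and> w X = 5
      \<or> D X \<ge> w X - 1 \<and> w X \<ge> 6"
  proof -
    consider "w X = 4" | "w X = 5" | "w X \<ge> 6" using w4 by linarith
    then show ?thesis
    proof cases
      case 1
      then show ?thesis using D_ge_4_if_odd_q[OF X] D_ge[OF X] by auto
    next
      case 2
      have "D X \<ge> 5"
      proof (cases "\<exists>L. L \<in> LC \<and> J X L \<and> e L X = 2")
        case True
        then show ?thesis using D_ge_5_if_triple[OF X w4] by auto
      next
        case False
        then have "e L X \<le> 1" if "L \<in> LC" "J X L" for L using e_le_2[OF that] that
          by (metis Suc_1 le_SucE One_nat_def)
        then show ?thesis using D_ge_if_odd[OF X] 2 by auto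
      qed
      then show ?thesis using 2 by simp
    next
      case 3
      then show ?thesis using D_ge[OF X] by simp
    qed
  qed
  define m where "m = int q * int (D X)"
  define s where "s = int q * int q"
  have "int (card K + q * D X) \<le> int (w X + 2 * q * (q + 1))" using 1 by linarith
  then have key: "int (card K) + m \<le> int (w X) + 2 * s + 2 * int q"
    unfolding m_def s_def by (simp add: algebra_simps)
  have q5: "int q \<ge> 5" using q_ge_5 by simp
  have m_ge: "int q * n \<le> m" if "n \<le> int (D X)" for n
    unfolding m_def using that by (intro mult_left_mono) auto
  have goal: "int (card K) \<le> 2 * s - 2 * int q + 4 \<or> \<not> odd q \<and> int (card K) \<le> 2 * s - int q + 4"
    using dcase
  proof (elim disjE conjE)
    assume "D X \<ge> 4" "w X = 4"
    then show ?thesis using key m_ge[of 4] by simp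
  next
    assume "\<not> odd q" "D X \<ge> 3" "w X = 4"
    then show ?thesis using key m_ge[of 3] by simp
  next
    assume "D X \<ge> 5" "w X = 5"
    then show ?thesis using key m_ge[of 5] q5 by simp
  next
    assume d: "D X \<ge> w X - 1" "w X \<ge> 6"
    then have "int q * (int (w X) - 1) \<le> m" by (intro m_ge) linarith
    moreover have "(int q - 1) * 6 \<le> (int q - 1) * int (w X)" using d q5 by (intro mult_left_mono) auto
    ultimately have "int q * 6 - 6 + int (w X) - int q \<le> m" unfolding left_diff_distrib right_diff_distrib by linarith
    then show ?thesis using key q5 by linarith
  qed
  have c1: "int (2 * q^2 - 2 * q + 4) = 2 * s - 2 * int q + 4"
    unfolding of_nat_add of_nat_diff[OF q2] s_def by (simp add: power2_eq_square)
  have c2: "int (2 * q^2 - q + 4) = 2 * s - int q + 4"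
    unfolding of_nat_add of_nat_diff[OF order_trans[OF _ q2, of q], simplified] s_def
    by (simp add: power2_eq_square)
  have "int (card K) \<le> int (if odd q then 2 * q^2 - 2 * q + 4 else 2 * q^2 - q + 4)"
    using goal c1 c2 q5 by auto
  then show ?thesis by linarith
qed

section \<open>Excess of line classes and moment identities\<close>

text \<open>A line of \<open>Ln L\<close> joining points of two such segments contains both segments
  entirely, hence at least four arc points.\<close>

lemma excess_class_unique:
  assumes L: "L \<in> LC" and X: "J X L" "e L X \<noteq> 0" and Y: "J Y L" "e L Y \<noteq> 0"
  shows "X = Y"
proof (rule ccontr)
  assume ne: "X \<noteq> Y"
  obtain p where p: "p \<in> cl X" "e L X = sg L p - 1" using e_attained[OF X(2)] by blast
  obtain r where r: "r \<in> cl Y" "e L Y = sg L r - 1" using e_attained[OF Y(2)] by blast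
  have P: "p \<in> Pts" "pcl p = X" "r \<in> Pts" "pcl r = Y" using p r cl_Pts unfolding cl_def by auto
  have "\<exists>!l. l \<in> Ln L \<and> I p l \<and> I r l" using P X Y ne by (intro line_join[OF L]) auto
  then obtain l where l: "l \<in> Ln L" "I p l" "I r l" by blast
  let ?A = "{p' \<in> K. sim L p p'}" and ?B = "{p' \<in> K. sim L r p'}"
  have "?A \<inter> ?B = {}" using P ne unfolding sim_def by auto
  then have "sg L p + sg L r = card (?A \<union> ?B)" unfolding sg_def using finite_K by (simp add: card_Un_disjoint)
  also have "\<dots> \<le> card {p' \<in> K. I p' l}"
    using sim_line[OF _ L P(1) _ l(1,2)] sim_line[OF _ L P(3) _ l(1,3)] K_Pts finite_K
    by (intro card_mono) auto
  also have "\<dots> \<le> 3" using arc[OF L l(1)] .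
  finally show False using p r X Y by linarith
qed

text \<open>At most one summand is nonzero, so this is the excess of the one special class if there
  is any. The sum form lets \<open>E_sum\<close> exchange line classes for point classes.\<close>

definition E :: "'c \<Rightarrow> nat" where "E L = (\<Sum>X\<in>{X \<in> PC. J X L}. e L X)"

lemma E_eq:
  assumes L: "L \<in> LC" and X: "X \<in> PC" "J X L" "e L X \<noteq> 0"
  shows "E L = e L X"
proof -
  have zero: "e L Y = 0" if "J Y L" "Y \<noteq> X" for Y
    using excess_class_unique[OF L that(1) _ X(2,3)] that(2) by blast
  have "E L = (\<Sum>Y\<in>{X}. e L Y)" unfolding E_def
    using X zero finite_PC by (intro sum.mono_neutral_right) auto
  then show ?thesis by simp
qed

lemma E_cases:
  assumes L: "L \<in> LC"
  obtains (zero) "E L = 0" "\<And>X. \<lbrakk>X \<in> PC; J X L\<rbrakk> \<Longrightarrow> e L X = 0"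
    | (special) X where "X \<in> PC" "J X L" "e L X \<noteq> 0" "E L = e L X" "cl X \<noteq> {}"
proof (cases "\<exists>X. X \<in> PC \<and> J X L \<and> e L X \<noteq> 0")
  case True
  then obtain X where X: "X \<in> PC" "J X L" "e L X \<noteq> 0" by blast
  obtain p where "p \<in> cl X" using e_attained[OF X(3)] by blast
  then show ?thesis using special[OF X E_eq[OF L X]] by blast
next
  case False
  then show ?thesis using zero unfolding E_def by simp
qed

lemma E_sum: "(\<Sum>L\<in>LC. E L) = (\<Sum>X\<in>PC. D X)"
  unfolding E_def D_def using sum.swap_restrict[OF finite_LC finite_PC, of e "\<lambda>L X. J X L"] .

lemma W_sum: "(\<Sum>L\<in>LC. W L) = (q + 1) * card K"
proof -
  have "(\<Sum>L\<in>LC. W L) = (\<Sum>p\<in>K. q + 1)"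
    unfolding W_def
    by (rule sum_multicount_gen) (use finite_LC finite_K card_lines K_Pts pcl_in in auto)
  then show ?thesis by simp
qed

lemma w_sum: "(\<Sum>X\<in>PC. w X) = card K"
proof -
  have "(\<Sum>X\<in>PC. card {p \<in> K. pcl p = X}) = (\<Sum>p\<in>K. 1)"
  proof (rule sum_multicount_gen)
    show "\<forall>p\<in>K. card {X \<in> PC. pcl p = X} = 1"
    proof
      fix p assume "p \<in> K"
      then have "{X \<in> PC. pcl p = X} = {pcl p}" using K_Pts pcl_in by auto
      then show "card {X \<in> PC. pcl p = X} = 1" by simp
    qed
  qed (use finite_PC finite_K in auto)
  then show ?thesis unfolding w_def cl_def by simp
qed

text \<open>Subtraction is truncated: an empty class contributes 0 just like a class of weight
  one.\<close>

definition Z :: nat where "Z = (\<Sum>X\<in>PC. w X - 1)"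

lemma card_K_le_Z: "card K \<le> Z + (q^2 + q + 1)"
proof -
  have "card K \<le> (\<Sum>X\<in>PC. (w X - 1) + 1)" unfolding w_sum[symmetric] by (rule sum_mono) simp
  then show ?thesis unfolding sum.distrib Z_def using card_PC by simp
qed

lemma Z_le_E: "Z \<le> (\<Sum>L\<in>LC. E L)"
  unfolding E_sum Z_def by (rule sum_mono) (rule D_ge)

lemma first_moment:
  assumes "\<And>L. L \<in> LC \<Longrightarrow> W L + r * E L \<le> C"
  shows "(q + 1) * card K + r * (\<Sum>L\<in>LC. E L) \<le> (q^2 + q + 1) * C"
proof -
  have "(\<Sum>L\<in>LC. W L + r * E L) \<le> (\<Sum>L\<in>LC. C)" by (rule sum_mono) (rule assms)
  then show ?thesis using card_LC W_sum by (simp add: sum.distrib sum_distrib_left)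
qed

text \<open>Count ordered pairs of arc points, equal ones included, with the line classes through
  both: \<open>q + 1\<close> line classes for a pair within one class, a single one
  otherwise.\<close>

lemma second_moment: "(\<Sum>L\<in>LC. W L ^ 2) = card K ^ 2 + q * (\<Sum>X\<in>PC. w X ^ 2)"
proof -
  have "(\<Sum>L\<in>LC. card {pp \<in> K \<times> K. J (pcl (fst pp)) L \<and> J (pcl (snd pp)) L})
      = (\<Sum>pp\<in>K \<times> K. 1 + q * of_bool (pcl (fst pp) = pcl (snd pp)))"
  proof (rule sum_multicount_gen)
    show "\<forall>pp\<in>K \<times> K. card {L \<in> LC. J (pcl (fst pp)) L \<and> J (pcl (snd pp)) L}
        = 1 + q * of_bool (pcl (fst pp) = pcl (snd pp))"
    proof
      fix pp assume pp: "pp \<in> K \<times> K"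
      then have P: "pcl (fst pp) \<in> PC" "pcl (snd pp) \<in> PC" using K_Pts pcl_in by auto
      show "card {L \<in> LC. J (pcl (fst pp)) L \<and> J (pcl (snd pp)) L}
        = 1 + q * of_bool (pcl (fst pp) = pcl (snd pp))"
      proof (cases "pcl (fst pp) = pcl (snd pp)")
        case True
        then show ?thesis using card_lines[OF P(2)] by simp
      next
        case False
        then show ?thesis using card_eq_1_if_Ex1[OF class_join[OF P]] by simp
      qed
    qed
  qed (use finite_LC finite_K in auto)
  moreover have "card {pp \<in> K \<times> K. J (pcl (fst pp)) L \<and> J (pcl (snd pp)) L} = W L ^ 2" for L
  proof -
    have "{pp \<in> K \<times> K. J (pcl (fst pp)) L \<and> J (pcl (snd pp)) L}
        = {p \<in> K. J (pcl p) L} \<times> {p \<in> K. J (pcl p) L}" by auto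
    then show ?thesis unfolding W_def by (simp add: card_cartesian_product power2_eq_square)
  qed
  moreover have "(\<Sum>pp\<in>K \<times> K. of_bool (pcl (fst pp) = pcl (snd pp))) = (\<Sum>X\<in>PC. w X ^ 2)"
  proof -
    have "(\<Sum>X\<in>PC. card {pp \<in> K \<times> K. pcl (fst pp) = X \<and> pcl (snd pp) = X})
        = (\<Sum>pp\<in>K \<times> K. of_bool (pcl (fst pp) = pcl (snd pp)))"
    proof (rule sum_multicount_gen)
      show "\<forall>pp\<in>K \<times> K. card {X \<in> PC. pcl (fst pp) = X \<and> pcl (snd pp) = X}
          = of_bool (pcl (fst pp) = pcl (snd pp))"
      proof
        fix pp assume pp: "pp \<in> K \<times> K"
        then have "{X \<in> PC. pcl (fst pp) = X \<and> pcl (snd pp) = X}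
            = (if pcl (fst pp) = pcl (snd pp) then {pcl (fst pp)} else {})"
          using K_Pts pcl_in by auto
        then show "card {X \<in> PC. pcl (fst pp) = X \<and> pcl (snd pp) = X}
          = of_bool (pcl (fst pp) = pcl (snd pp))" by simp
      qed
    qed (use finite_PC finite_K in auto)
    moreover have "card {pp \<in> K \<times> K. pcl (fst pp) = X \<and> pcl (snd pp) = X} = w X ^ 2" for X
    proof -
      have "{pp \<in> K \<times> K. pcl (fst pp) = X \<and> pcl (snd pp) = X} = cl X \<times> cl X"
        unfolding cl_def by auto
      then show ?thesis unfolding w_def by (simp add: card_cartesian_product power2_eq_square)
    qed
    ultimately show ?thesis by simp
  qed
  moreover have "(\<Sum>pp\<in>K \<times> K. 1 + q * of_bool (pcl (fst pp) = pcl (snd pp)))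
      = card K ^ 2 + q * (\<Sum>pp\<in>K \<times> K. of_bool (pcl (fst pp) = pcl (snd pp)))"
    unfolding sum.distrib sum_distrib_left[symmetric] by (simp add: card_cartesian_product power2_eq_square)
  ultimately show ?thesis by simp
qed

section \<open>Arcs with at most three points in each class\<close>

lemma W_cap_zero:
  assumes L: "L \<in> LC" and zero: "\<And>X. \<lbrakk>X \<in> PC; J X L\<rbrakk> \<Longrightarrow> e L X = 0"
    and light: "\<And>X. w X \<le> 3" and q3: "\<not> 3 dvd q"
  shows "W L \<le> 2 * q + 1"
  unfolding W_def
proof (rule cap[OF L])
  fix p p' assume p: "p \<in> {p \<in> K. J (pcl p) L}" "p' \<in> {p \<in> K. J (pcl p) L}" and s: "sim L p p'"
  show "p = p'"
  proof (rule ccontr)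
    assume ne: "p \<noteq> p'"
    have P: "p \<in> Pts" "p \<in> cl (pcl p)" using p K_Pts unfolding cl_def by auto
    have "{p, p'} \<subseteq> {r \<in> K. sim L p r}" using s p sim_refl[OF L P(1)] by auto
    then have "card {p, p'} \<le> sg L p" unfolding sg_def using finite_K by (intro card_mono) auto
    then have "e L (pcl p) \<ge> 1" using e_ge[OF P(2), of L] ne by simp
    then show False using zero[of "pcl p"] pcl_in[OF P(1)] p by simp
  qed
next
  fix l assume l: "l \<in> Ln L"
  have "card {p \<in> {p \<in> K. J (pcl p) L}. I p l} \<le> card {p \<in> K. I p l}"
    using finite_K by (intro card_mono) auto
  then show "card {p \<in> {p \<in> K. J (pcl p) L}. I p l} \<le> 3" using arc[OF L l] by linarith
next
  fix X
  have "card {p \<in> {p \<in> K. J (pcl p) L}. pcl p = X} \<le> card (cl X)"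
    unfolding cl_def using finite_K by (intro card_mono) auto
  then show "card {p \<in> {p \<in> K. J (pcl p) L}. pcl p = X} \<le> 3" using light[of X] unfolding w_def by linarith
qed (use K_Pts q3 in auto)

text \<open>A line class with positive excess has weight at most \<open>q + 3\<close>, so the cap
  matters only where the excess vanishes.\<close>

lemma W_cap:
  assumes L: "L \<in> LC" and light: "\<And>X. w X \<le> 3" and q3: "\<not> 3 dvd q"
  shows "W L \<le> 2 * q + 1"
  using L
proof (cases rule: E_cases)
  case zero
  then show ?thesis using W_cap_zero[OF L _ light q3] by blast
next
  case (special X)
  have "q * 1 \<le> q * e L X" using special by (intro mult_le_mono2) simp
  then have "W L + q \<le> w X + 2 * q" using excess_bound[OF special(5) L special(2)] by linarith
  then show ?thesis using light[of X] q_ge_5 by linarith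
qed

lemma bound_if_three_dvd:
  assumes light: "\<And>X. w X \<le> 3" and q3: "3 dvd q"
  shows "card K \<le> (if odd q then 2 * q^2 - 2 * q + 4 else 2 * q^2 - q + 4)"
proof -
  have "W L + q * E L \<le> 2 * q + 3" if L: "L \<in> LC" for L
    using L
  proof (cases rule: E_cases)
    case zero
    show ?thesis
    proof (cases "\<exists>p\<in>K. J (pcl p) L")
      case True
      then obtain p where p: "p \<in> K" "J (pcl p) L" by blast
      then have "cl (pcl p) \<noteq> {}" unfolding cl_def by auto
      then have "W L \<le> w (pcl p) + 2 * q" using excess_bound[OF _ L p(2)] by linarith
      then show ?thesis using light[of "pcl p"] zero by simp
    next
      case False
      then have empty: "{p \<in> K. J (pcl p) L} = {}" by blast
      show ?thesis unfolding W_def zero(1) empty by simp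
    qed
  next
    case (special X)
    then show ?thesis using excess_bound[OF special(5) L special(2)] light[of X] by simp
  qed
  from first_moment[OF this]
  have 1: "(q + 1) * card K + q * (\<Sum>L\<in>LC. E L) \<le> (q^2 + q + 1) * (2 * q + 3)" .
  have "card K \<le> (\<Sum>L\<in>LC. E L) + (q^2 + q + 1)" using card_K_le_Z Z_le_E by linarith
  then have "q * card K \<le> q * ((\<Sum>L\<in>LC. E L) + (q^2 + q + 1))" by (rule mult_le_mono2)
  then have 2: "(2 * q + 1) * card K \<le> (q^2 + q + 1) * (2 * q + 3) + q * (q^2 + q + 1)"
    using 1 by (simp add: algebra_simps)
  \<comment> \<open>The abstract plane only fixes \<open>q \<ge> 5\<close>, so \<open>q = 6\<close>
    occurs: the estimate gives 69, within the even bound 70. From 8 on the cubic q^3 - 8q^2 + 2q + 2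
    is positive, which yields the stronger bound for every parity.\<close>
  have "q = 6 \<or> q \<ge> 8" using q3 q_ge_5 by presburger
  then show ?thesis
  proof
    assume q6: "q = 6"
    show ?thesis using 2 unfolding q6 by simp
  next
    assume q8: "q \<ge> 8"
    have "card K < 2 * q^2 - 2 * q + 5"
    proof (rule ccontr)
      assume "\<not> ?thesis"
      then have "int (2 * q^2 + 5) \<le> int (card K + 2 * q)" by linarith
      then have k: "2 * (int q)^2 - 2 * int q + 5 \<le> int (card K)" by simp
      have "int ((2 * q + 1) * card K) \<le> int ((q^2 + q + 1) * (2 * q + 3) + q * (q^2 + q + 1))"
        using 2 by (simp only: of_nat_le_iff)
      then have "(2 * int q + 1) * int (card K) \<le> ((int q)^2 + int q + 1) * (3 * int q + 3)"
        by (simp add: algebra_simps)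
      moreover have "(2 * int q + 1) * (2 * (int q)^2 - 2 * int q + 5) \<le> (2 * int q + 1) * int (card K)"
        using k by (intro mult_left_mono) auto
      ultimately have ineq: "(2 * int q + 1) * (2 * (int q)^2 - 2 * int q + 5)
          \<le> ((int q)^2 + int q + 1) * (3 * int q + 3)"
        by linarith
      have "8 * (int q)^2 \<le> int q * (int q)^2" using q8 by (intro mult_right_mono) auto
      moreover have "int q * (int q)^2 - 8 * (int q)^2 + 2 * int q + 2 \<le> 0"
        using ineq by (simp add: algebra_simps power2_eq_square)
      ultimately show False using q8 by linarith
    qed
    then have "card K \<le> 2 * q^2 - 2 * q + 4" by linarith
    then show ?thesis by (auto intro: order_trans)
  qed
qed

text \<open>The pencil argument, with \<open>W_cap\<close> for the directions without excess. A
  triple segment leaves weight at most 3 on its line class. Otherwise the three points determine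
  three directions; the factor \<open>q - 2\<close> is chosen so that excess 0 (weight at most 2q +
  1) and excess 1 (weight at most q + 3) satisfy one common inequality.\<close>

lemma bound_if_class_of_three:
  assumes light: "\<And>X. w X \<le> 3" and q3: "\<not> 3 dvd q" and X: "X \<in> PC" "w X = 3"
  shows "card K \<le> 2 * q^2 - 2 * q + 4"
proof -
  let ?A = "{L \<in> LC. J X L}"
  have fA: "finite ?A" using finite_LC by simp
  have ne: "cl X \<noteq> {}" using X(2) unfolding w_def by auto
  have sumW: "(\<Sum>L\<in>?A. W L) = card K + 3 * q" using W_pencil_sum[OF X(1)] X(2) by simp
  have main: "card K + 2 * q \<le> 2 * q^2 + 4"
  proof (cases "\<exists>L\<in>?A. e L X = 2")
    case True
    then obtain L where L: "L \<in> ?A" "e L X = 2" by blast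
    have "W L \<le> 3" using excess_bound[OF ne, of L] L X by simp
    moreover have "(\<Sum>M\<in>?A - {L}. W M) \<le> (\<Sum>M\<in>?A - {L}. 2 * q + 1)"
      by (rule sum_mono) (use W_cap[OF _ light q3] in auto)
    moreover have "card (?A - {L}) = q" using card_lines[OF X(1)] L(1) fA by simp
    ultimately have "card K + 3 * q \<le> 3 + q * (2 * q + 1)"
      using sumW sum.remove[OF fA L(1), of W] by simp
    then show ?thesis by (simp add: power2_eq_square algebra_simps)
  next
    case False
    have e1: "e L X \<le> 1" if "L \<in> LC" "J X L" for L
      using e_le_2[OF that] False that by (metis (mono_tags, lifting) Suc_1 le_SucE mem_Collect_eq One_nat_def)
    have D3: "D X \<ge> 3" using D_ge_if_odd[OF X(1)] e1 X(2) by simp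
    have "W L + (q - 2) * e L X \<le> 2 * q + 1" if L: "L \<in> ?A" for L
    proof (cases "e L X = 0")
      case True
      then show ?thesis using W_cap[OF _ light q3, of L] L by simp
    next
      case False
      then have "e L X = 1" using e1[of L] L by simp
      then show ?thesis using excess_bound[OF ne, of L] L X q_ge_5 by simp
    qed
    then have "(\<Sum>L\<in>?A. W L + (q - 2) * e L X) \<le> (\<Sum>L\<in>?A. 2 * q + 1)" by (rule sum_mono)
    then have 1: "card K + 3 * q + (q - 2) * D X \<le> (q + 1) * (2 * q + 1)"
      unfolding sum.distrib sumW sum_distrib_left[symmetric] D_def[symmetric] using card_lines[OF X(1)] by simp
    have "(q - 2) * 3 \<le> (q - 2) * D X" using D3 by (rule mult_le_mono2)
    then have "card K + 3 * q + (q - 2) * 3 \<le> (q + 1) * (2 * q + 1)" using 1 by linarith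
    then have "card K + 3 * q + (q - 2) * 3 \<le> 2 * q^2 + 3 * q + 1"
      by (simp add: power2_eq_square algebra_simps)
    then show ?thesis using q_ge_5 by linarith
  qed
  then show ?thesis by linarith
qed

text \<open>Line classes with and without excess share the estimate with factor
  \<open>q - 1\<close>; together with \<open>card_K_le_Z\<close> the first moment gives 2|K| \<le>
  3(q^2 + q + 1). This contradicts |K| \<ge> 2q^2 - 2q + 5 exactly when q^2 - 7q + 7 > 0, that is
  from q = 6 on.\<close>

lemma bound_if_classes_le_two:
  assumes light: "\<And>X. w X \<le> 2" and q3: "\<not> 3 dvd q"
  shows "card K \<le> 2 * q^2 - 2 * q + 4"
proof -
  have light3: "w X \<le> 3" for X using light[of X] by linarith
  have "W L + (q - 1) * E L \<le> 2 * q + 1" if L: "L \<in> LC" for L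
    using L
  proof (cases rule: E_cases)
    case zero
    then show ?thesis using W_cap[OF L light3 q3] by simp
  next
    case (special X)
    have "W L + q * E L \<le> 2 + 2 * q" using excess_bound[OF special(5) L special(2)] light[of X] special by simp
    moreover have "q * E L = (q - 1) * E L + E L" using q_ge_5
      by (metis add_mult_distrib le_add_diff_inverse2 mult_1 one_le_numeral order_trans)
    ultimately show ?thesis using special by linarith
  qed
  from first_moment[OF this]
  have 1: "(q + 1) * card K + (q - 1) * (\<Sum>L\<in>LC. E L) \<le> (q^2 + q + 1) * (2 * q + 1)" .
  have KE: "card K \<le> (\<Sum>L\<in>LC. E L) + (q^2 + q + 1)" using card_K_le_Z Z_le_E by linarith
  have q1: "int (q - 1) = int q - 1" using q_ge_5 by simp
  have "int ((q + 1) * card K + (q - 1) * (\<Sum>L\<in>LC. E L)) \<le> int ((q^2 + q + 1) * (2 * q + 1))"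
    using 1 by (simp only: of_nat_le_iff)
  then have 2: "(int q + 1) * int (card K) + (int q - 1) * int (\<Sum>L\<in>LC. E L)
      \<le> ((int q)^2 + int q + 1) * (2 * int q + 1)"
    unfolding of_nat_add of_nat_mult q1 by simp
  have KE': "int (card K) - ((int q)^2 + int q + 1) \<le> int (\<Sum>L\<in>LC. E L)"
    using KE by (smt (verit) of_nat_1 of_nat_add of_nat_le_iff of_nat_power)
  have "(int q - 1) * (int (card K) - ((int q)^2 + int q + 1)) \<le> (int q - 1) * int (\<Sum>L\<in>LC. E L)"
    using KE' q_ge_5 by (intro mult_left_mono) auto
  then have "int q * (2 * int (card K)) \<le> int q * (3 * ((int q)^2 + int q + 1))"
    using 2 by (simp add: algebra_simps)
  then have K32: "2 * int (card K) \<le> 3 * ((int q)^2 + int q + 1)" using q_ge_5 by simp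
  have "int (card K) < 2 * (int q)^2 - 2 * int q + 5"
  proof (cases "q = 5")
    case False
    then have "int q \<ge> 6" using q_ge_5 by simp
    then have "6 * (int q - 1) \<le> int q * (int q - 1)" by (intro mult_right_mono) auto
    then show ?thesis using K32 \<open>int q \<ge> 6\<close> by (simp add: power2_eq_square algebra_simps)
  next
    case q: True
    let ?k = "int (card K)" and ?E = "\<Sum>L\<in>LC. int (E L)"
    \<comment> \<open>Equivalently (W - 9)(W - 10) \<ge> 6E. Integrality gives this for E = 0, where
      the roots are consecutive; the factor 6 makes it an equality at E = 1 and W = 7, the largest
      weight allowed with that excess.\<close>
    have pt: "(11 - int (W L)) * (8 - int (W L)) \<ge> - 2 + 6 * int (E L)" if L: "L \<in> LC" for L
      using L
    proof (cases rule: E_cases)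
      case zero
      have "(int (W L) - 9) * (int (W L) - 10) \<ge> 0"
        by (cases "int (W L) \<le> 9") (auto intro: mult_nonneg_nonneg mult_nonpos_nonpos)
      then show ?thesis using zero by (simp add: algebra_simps)
    next
      case (special X)
      have WE: "int (W L) \<le> 12 - 5 * int (E L)"
        using excess_bound[OF special(5) L special(2)] light[of X] special q by simp
      have E1: "int (E L) \<ge> 1" using special by simp
      have "(5 * int (E L) - 1) * (5 * int (E L) - 4) \<le> (11 - int (W L)) * (8 - int (W L))"
        using WE E1 by (intro mult_mono) auto
      moreover have "0 \<le> (25 * int (E L) - 6) * (int (E L) - 1)" using E1 by simp
      then have "- 2 + 6 * int (E L) \<le> (5 * int (E L) - 1) * (5 * int (E L) - 4)"
        by (simp add: algebra_simps)
      ultimately show ?thesis by linarith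
    qed
    \<comment> \<open>For weights 0, 1, 2 the square is linear in the weight and the truncated
      \<open>w X - 1\<close>, so the second moment involves only |K| and \<open>Z\<close>.\<close>
    have w2: "w X ^ 2 = w X + 2 * (w X - 1)" for X
    proof -
      have "w X = 0 \<or> w X = 1 \<or> w X = 2" using light[of X] by linarith
      then show ?thesis by (auto simp: power2_eq_square)
    qed
    have cL: "int (card LC) = 31" using card_LC q by simp
    have W1: "(\<Sum>L\<in>LC. int (W L)) = 6 * ?k"
      using W_sum q unfolding of_nat_sum[symmetric] by simp
    have "(\<Sum>X\<in>PC. w X ^ 2) = card K + 2 * Z"
      unfolding w2 sum.distrib Z_def w_sum sum_distrib_left[symmetric] ..
    then have W2n: "(\<Sum>L\<in>LC. W L ^ 2) = card K ^ 2 + 5 * (card K + 2 * Z)"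
      using second_moment q by simp
    have W2: "(\<Sum>L\<in>LC. int (W L) ^ 2) = ?k ^ 2 + 5 * (?k + 2 * int Z)"
      using arg_cong[OF W2n, of int] by simp
    have "(\<Sum>L\<in>LC. - 2 + 6 * int (E L)) \<le> (\<Sum>L\<in>LC. (11 - int (W L)) * (8 - int (W L)))"
      by (rule sum_mono) (rule pt)
    also have "\<dots> = (\<Sum>L\<in>LC. 88 - 19 * int (W L) + int (W L) ^ 2)"
      by (intro sum.cong) (auto simp: power2_eq_square algebra_simps)
    also have "\<dots> = 31 * 88 - 19 * (6 * ?k) + (?k ^ 2 + 5 * (?k + 2 * int Z))"
      unfolding sum.distrib sum_subtractf sum_distrib_left[symmetric] W1 W2 using cL by simp
    finally have sm: "- 62 + 6 * ?E \<le> 31 * 88 - 19 * (6 * ?k) + (?k ^ 2 + 5 * (?k + 2 * int Z))"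
      unfolding sum.distrib sum_distrib_left[symmetric] using cL by simp
    have ZE: "int Z \<le> ?E" using Z_le_E by (metis of_nat_le_iff of_nat_sum)
    have fm: "6 * ?k + 4 * ?E \<le> 341" using 2 q by simp
    have kZ: "?k \<le> int Z + 31" using card_K_le_Z q by simp
    show ?thesis
    proof (rule ccontr)
      assume "\<not> ?thesis"
      then have k45: "?k \<ge> 45" using q by simp
      \<comment> \<open>For 45 and 46 points the first moment bounds the total excess by 17 and 16,
        whereas the quadratic estimate with \<open>Z\<close> at most the total excess forces at
        least 23 and 27.\<close>
      have "?k \<le> 46" using fm kZ ZE by linarith
      then have "?k = 45 \<or> ?k = 46" using k45 by linarith
      then show False using sm fm kZ ZE by (elim disjE) auto
    qed
  qed
  moreover have "2 * q \<le> 2 * q^2" by (simp add: power2_eq_square)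
  then have "int (2 * q^2 - 2 * q + 4) = 2 * (int q)^2 - 2 * int q + 4"
    unfolding of_nat_add by (subst of_nat_diff) simp_all
  ultimately show ?thesis by linarith
qed

theorem arc_bound: "card K \<le> (if odd q then 2 * q^2 - 2 * q + 4 else 2 * q^2 - q + 4)"
proof (cases "\<exists>X\<in>PC. w X \<ge> 4")
  case True
  then show ?thesis using bound_if_heavy_class by blast
next
  case False
  have light: "w X \<le> 3" for X
  proof (cases "X \<in> PC")
    case False
    then have "cl X = {}" using K_Pts pcl_in unfolding cl_def by auto
    then show ?thesis unfolding w_def by simp
  qed (use \<open>\<not> (\<exists>X\<in>PC. w X \<ge> 4)\<close> in force)
  show ?thesis
  proof (cases "3 dvd q")
    case True
    then show ?thesis using bound_if_three_dvd light by blast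
  next
    case q3: False
    have "card K \<le> 2 * q^2 - 2 * q + 4"
    proof (cases "\<exists>X\<in>PC. w X = 3")
      case True
      then show ?thesis using bound_if_class_of_three[OF light q3] by blast
    next
      case F: False
      have "w X \<le> 2" for X
      proof (cases "X \<in> PC")
        case True
        then show ?thesis using F light[of X] by force
      next
        case False
        then have "cl X = {}" using K_Pts pcl_in unfolding cl_def by auto
        then show ?thesis unfolding w_def by simp
      qed
      then show ?thesis using bound_if_classes_le_two q3 by blast
    qed
    then show ?thesis by (auto intro: order_trans)
  qed
qed

end

section \<open>Coordinates over a chain ring of length two\<close>

text \<open>Rows act on columns from the left: right linear in the column, left linear in the row.
  The order of factors matters throughout, as the ring may be noncommutative.\<close>

definition dot :: "'r::ring_1 vec3 \<Rightarrow> 'r vec3 \<Rightarrow> 'r" where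
  "dot a v = fst a * fst v + fst (snd a) * fst (snd v) + snd (snd a) * snd (snd v)"

definition lsm :: "'r::ring_1 \<Rightarrow> 'r vec3 \<Rightarrow> 'r vec3" where
  "lsm r a = (r * fst a, r * fst (snd a), r * snd (snd a))"

lemma vadd_eq_plus: "vadd x y = x + y"
  by (simp add: vadd_def prod_eq_iff)

lemma dot_add_left: "dot (a + b) v = dot a v + dot b v"
  and dot_add_right: "dot a (v + w) = dot a v + dot a w"
  and dot_diff_left: "dot (a - b) v = dot a v - dot b v"
  and dot_diff_right: "dot a (v - w) = dot a v - dot a w"
  and dot_vsmul: "dot a (vsmul v r) = dot a v * r"
  and dot_lsm: "dot (lsm r a) v = r * dot a v"
  by (simp_all add: dot_def lsm_def vsmul_def algebra_simps)

lemmas dot_simps = dot_add_left dot_add_right dot_diff_left dot_diff_right dot_vsmul dot_lsm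

lemma vsmul_assoc: "vsmul (vsmul v r) s = vsmul v (r * s)"
  and vsmul_one: "vsmul v 1 = v"
  and vsmul_add: "vsmul v (r + s) = vsmul v r + vsmul v s"
  and vsmul_diff: "vsmul v (r - s) = vsmul v r - vsmul v s"
  and vsmul_add_left: "vsmul (v + w) r = vsmul v r + vsmul w r"
  and vsmul_diff_left: "vsmul (v - w) r = vsmul v r - vsmul w r"
  and vsmul_zero: "vsmul v 0 = 0"
  and lsm_assoc: "lsm r (lsm s a) = lsm (r * s) a"
  and lsm_one: "lsm 1 a = a"
  and lsm_add: "lsm (r + s) a = lsm r a + lsm s a"
  and lsm_diff: "lsm (r - s) a = lsm r a - lsm s a"
  and lsm_add_right: "lsm r (a + b) = lsm r a + lsm r b"
  and lsm_diff_right: "lsm r (a - b) = lsm r a - lsm r b"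
  and lsm_zero: "lsm 0 a = 0"
  by (simp_all add: vsmul_def lsm_def prod_eq_iff algebra_simps)

lemmas vec_simps = vsmul_assoc vsmul_one vsmul_add vsmul_diff vsmul_add_left vsmul_diff_left vsmul_zero
  lsm_assoc lsm_one lsm_add lsm_diff lsm_add_right lsm_diff_right lsm_zero

lemma dot_eqI:
  assumes "\<And>v. dot a v = dot b v"
  shows "a = b"
  using assms[of "(1, 0, 0)"] assms[of "(0, 1, 0)"] assms[of "(0, 0, 1)"]
  by (simp add: dot_def prod_eq_iff)

text \<open>A basis \<open>x, y, z\<close> of column vectors together with its dual basis \<open>a, b, c\<close> of row vectors.\<close>

definition db :: "'r::ring_1 vec3 \<Rightarrow> 'r vec3 \<Rightarrow> 'r vec3 \<Rightarrow> 'r vec3 \<Rightarrow> 'r vec3 \<Rightarrow> 'r vec3 \<Rightarrow> bool" where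
  "db x y z a b c \<longleftrightarrow>
     dot a x = 1 \<and> dot a y = 0 \<and> dot a z = 0 \<and>
     dot b x = 0 \<and> dot b y = 1 \<and> dot b z = 0 \<and>
     dot c x = 0 \<and> dot c y = 0 \<and> dot c z = 1 \<and>
     (\<forall>v. v = vsmul x (dot a v) + vsmul y (dot b v) + vsmul z (dot c v))"

lemma db_dots:
  assumes "db x y z a b c"
  shows "dot a x = 1" "dot a y = 0" "dot a z = 0" "dot b x = 0" "dot b y = 1" "dot b z = 0"
    "dot c x = 0" "dot c y = 0" "dot c z = 1"
  using assms unfolding db_def by auto

lemma db_col:
  assumes "db x y z a b c"
  shows "v = vsmul x (dot a v) + vsmul y (dot b v) + vsmul z (dot c v)"
  using assms unfolding db_def by blast

lemma db_row:
  assumes "db x y z a b c"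
  shows "m = lsm (dot m x) a + lsm (dot m y) b + lsm (dot m z) c"
proof (rule dot_eqI)
  fix v
  have "dot m v = dot m (vsmul x (dot a v) + vsmul y (dot b v) + vsmul z (dot c v))"
    using db_col[OF assms, of v] by simp
  then show "dot m v = dot (lsm (dot m x) a + lsm (dot m y) b + lsm (dot m z) c) v"
    by (simp add: dot_simps)
qed

lemma db_swap: "db x y z a b c \<Longrightarrow> db x z y a c b"
  unfolding db_def by (simp add: ac_simps)

text \<open>The translates of {0, c} partition the ring into pairs.\<close>

lemma even_card_if_involution:
  fixes c :: "'r::{ring_1,finite}"
  assumes "c \<noteq> 0" "c + c = 0"
  shows "even (card (UNIV :: 'r set))"
proof -
  let ?C = "range (\<lambda>x::'r. {x, x + c})"
  have cc: "x + c + c = x" for x using assms(2) by (simp add: add.assoc)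
  have "2 * card ?C = card (\<Union>?C)"
  proof (rule card_partition)
    show "card s = 2" if "s \<in> ?C" for s using that assms(1) by auto
    show "s \<inter> t = {}" if st: "s \<in> ?C" "t \<in> ?C" "s \<noteq> t" for s t
    proof -
      obtain x where x: "s = {x, x + c}" using st(1) by blast
      obtain y where y: "t = {y, y + c}" using st(2) by blast
      show ?thesis
      proof (rule ccontr)
        assume "s \<inter> t \<noteq> {}"
        then obtain u where "u \<in> s" "u \<in> t" by blast
        then have "u = x \<or> u = x + c" "u = y \<or> u = y + c" using x y by auto
        then have "y = x \<or> y = x + c" using cc by (metis add_right_cancel)
        then have "s = t" using x y cc by auto
        then show False using st by simp
      qed
    qed
  qed auto
  moreover have "\<Union>?C = UNIV" by auto
  ultimately show ?thesis by (metis dvd_triv_left)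
qed

locale chain_ring =
  fixes N :: "'r::{ring_1,finite} set" and q :: nat
  assumes chain: "chain_ring2 N" and card_quot: "card (UNIV :: 'r set) = q * card N"
    and q_ge_5: "q \<ge> 5"
begin

section \<open>Units, annihilators and residues in the chain ring\<close>

lemma left_ideal_iff: "left_ideal A \<longleftrightarrow> A = UNIV \<or> A = N \<or> A = {0}"
  and right_ideal_iff: "right_ideal A \<longleftrightarrow> A = UNIV \<or> A = N \<or> A = {0}"
proof -
  have "{I. left_ideal I} = {UNIV, N, {0}}" "{I. right_ideal I} = {UNIV, N, {0}}"
    using chain unfolding chain_ring2_def by simp_all
  then show "left_ideal A \<longleftrightarrow> A = UNIV \<or> A = N \<or> A = {0}"
      "right_ideal A \<longleftrightarrow> A = UNIV \<or> A = N \<or> A = {0}"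
    by (metis (no_types) insert_iff mem_Collect_eq singletonD)+
qed

lemma left_N: "left_ideal N" and right_N: "right_ideal N"
  unfolding left_ideal_iff right_ideal_iff by simp_all

lemma N_zero: "0 \<in> N" and N_add: "a \<in> N \<Longrightarrow> b \<in> N \<Longrightarrow> a + b \<in> N"
  and N_uminus: "a \<in> N \<Longrightarrow> - a \<in> N" and N_mult_left: "a \<in> N \<Longrightarrow> r * a \<in> N"
  and N_mult_right: "a \<in> N \<Longrightarrow> a * r \<in> N"
  using left_N right_N unfolding left_ideal_def right_ideal_def by auto

lemma N_diff: "a \<in> N \<Longrightarrow> b \<in> N \<Longrightarrow> a - b \<in> N"
  using N_add[of a "- b"] N_uminus by simp

lemma N_diff_iff: "a \<in> N \<Longrightarrow> b - a \<in> N \<longleftrightarrow> b \<in> N"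
  using N_add[of "b - a" a] N_diff by auto

lemma N_cong: "a - b \<in> N \<Longrightarrow> a \<in> N \<longleftrightarrow> b \<in> N"
  using N_add[of "a - b" b] N_diff[of a "a - b"] by auto

lemma N_prod: "a \<in> N \<Longrightarrow> b \<in> N \<Longrightarrow> a * b = 0"
  using chain unfolding chain_ring2_def by blast

lemmas N_closed = N_zero N_add N_uminus N_mult_left N_mult_right N_diff

lemma right_ideal_principal: "right_ideal (range (\<lambda>s. r * s))"
  unfolding right_ideal_def
proof (intro conjI ballI allI)
  show "0 \<in> range (\<lambda>s. r * s)" by (rule range_eqI[where x = 0]) simp
next
  fix a b assume "a \<in> range (\<lambda>s. r * s)" "b \<in> range (\<lambda>s. r * s)"
  then obtain s t where "a = r * s" "b = r * t" by blast
  then show "a + b \<in> range (\<lambda>s. r * s)" by (intro range_eqI[where x = "s + t"]) (simp add: distrib_left)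
next
  fix a assume "a \<in> range (\<lambda>s. r * s)"
  then obtain s where a: "a = r * s" by blast
  show "- a \<in> range (\<lambda>s. r * s)" unfolding a by (intro range_eqI[where x = "- s"]) simp
  fix t show "a * t \<in> range (\<lambda>s. r * s)" unfolding a
    by (intro range_eqI[where x = "s * t"]) (simp add: mult.assoc)
qed

lemma left_ideal_principal: "left_ideal (range (\<lambda>s. s * r))"
  unfolding left_ideal_def
proof (intro conjI ballI allI)
  show "0 \<in> range (\<lambda>s. s * r)" by (rule range_eqI[where x = 0]) simp
next
  fix a b assume "a \<in> range (\<lambda>s. s * r)" "b \<in> range (\<lambda>s. s * r)"
  then obtain s t where "a = s * r" "b = t * r" by blast
  then show "a + b \<in> range (\<lambda>s. s * r)" by (intro range_eqI[where x = "s + t"]) (simp add: distrib_right)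
next
  fix a assume "a \<in> range (\<lambda>s. s * r)"
  then obtain s where a: "a = s * r" by blast
  show "- a \<in> range (\<lambda>s. s * r)" unfolding a by (intro range_eqI[where x = "- s"]) simp
  fix t show "t * a \<in> range (\<lambda>s. s * r)" unfolding a
    by (intro range_eqI[where x = "t * s"]) (simp add: mult.assoc)
qed

lemma self_in_principal:
  fixes r :: 'r
  shows "r \<in> range (\<lambda>s. r * s)" "r \<in> range (\<lambda>s. s * r)"
proof -
  show "r \<in> range (\<lambda>s. r * s)" by (rule range_eqI[where x = 1]) simp
  show "r \<in> range (\<lambda>s. s * r)" by (rule range_eqI[where x = 1]) simp
qed

text \<open>The principal one-sided ideals of \<open>r\<close> contain \<open>r\<close>, so neither
  is \<open>N\<close> or \<open>{0}\<close>; by the chain condition both are the whole ring.\<close>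

lemma unit_ex:
  assumes "r \<notin> N"
  shows "\<exists>s. r * s = 1 \<and> s * r = 1"
proof -
  have "r \<noteq> 0" using assms N_zero by auto
  then have "range (\<lambda>s. r * s) = UNIV" "range (\<lambda>s. s * r) = UNIV"
    using right_ideal_iff[THEN iffD1, OF right_ideal_principal[of r]] left_ideal_iff[THEN iffD1, OF left_ideal_principal[of r]]
      self_in_principal[of r] assms by auto
  then obtain s t where "r * s = 1" "t * r = 1" by (metis UNIV_I imageE)
  moreover then have "t = s" by (metis mult.assoc mult_1_left mult_1_right)
  ultimately show ?thesis by blast
qed

definition ri :: "'r \<Rightarrow> 'r" where "ri r = (SOME s. r * s = 1 \<and> s * r = 1)"

lemma ri_right: "r \<notin> N \<Longrightarrow> r * ri r = 1" and ri_left: "r \<notin> N \<Longrightarrow> ri r * r = 1"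
  using someI_ex[OF unit_ex] unfolding ri_def by blast+

lemma ri_right_assoc: "r \<notin> N \<Longrightarrow> r * (ri r * s) = s" and ri_left_assoc: "r \<notin> N \<Longrightarrow> ri r * (r * s) = s"
  using ri_right ri_left by (simp_all add: mult.assoc[symmetric])

lemma one_notin_N: "1 \<notin> N"
proof
  assume "1 \<in> N"
  then have "N = UNIV" using N_mult_left[of 1] by auto
  then show False using chain unfolding chain_ring2_def by simp
qed

lemma ri_notin_N: "r \<notin> N \<Longrightarrow> ri r \<notin> N"
  using ri_right[of r] N_mult_left[of "ri r" r] one_notin_N by auto

lemma unit_mult_in_N: "r \<notin> N \<Longrightarrow> r * a \<in> N \<longleftrightarrow> a \<in> N"
  using ri_left_assoc[of r a] N_mult_left[of "r * a" "ri r"] N_mult_left[of a r] by auto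

lemma N_gen_right: "\<lbrakk>a \<in> N; a \<noteq> 0; b \<in> N\<rbrakk> \<Longrightarrow> \<exists>r. b = a * r"
proof -
  assume a: "a \<in> N" "a \<noteq> 0" "b \<in> N"
  have "range (\<lambda>s. a * s) \<noteq> {0}" using self_in_principal(1)[of a] a by auto
  then have "b \<in> range (\<lambda>s. a * s)" using right_ideal_iff[THEN iffD1, OF right_ideal_principal[of a]] a by auto
  then show ?thesis by auto
qed

lemma N_gen_left: "\<lbrakk>a \<in> N; a \<noteq> 0; b \<in> N\<rbrakk> \<Longrightarrow> \<exists>r. b = r * a"
proof -
  assume a: "a \<in> N" "a \<noteq> 0" "b \<in> N"
  have "range (\<lambda>s. s * a) \<noteq> {0}" using self_in_principal(2)[of a] a by auto
  then have "b \<in> range (\<lambda>s. s * a)" using left_ideal_iff[THEN iffD1, OF left_ideal_principal[of a]] a by auto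
  then show ?thesis by auto
qed

lemma ann_left: "r * a = 0 \<Longrightarrow> a \<noteq> 0 \<Longrightarrow> r \<in> N"
  by (rule ccontr) (metis mult_zero_right ri_left_assoc)

lemma ann_right: "a * r = 0 \<Longrightarrow> a \<noteq> 0 \<Longrightarrow> r \<in> N"
  by (rule ccontr) (metis mult.assoc mult_1_right mult_zero_left ri_right)

lemma N_nonzero: "\<exists>a\<in>N. a \<noteq> 0"
proof -
  have "N \<noteq> {0}" using chain unfolding chain_ring2_def by (elim conjE)
  then show ?thesis using N_zero by blast
qed

lemma card_coset: "card {r. r - s \<in> N} = card N"
proof -
  have "{r. r - s \<in> N} = (\<lambda>n. n + s) ` N" by (auto simp: image_iff) (metis diff_add_cancel)
  then show ?thesis by (simp add: card_image inj_on_def)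
qed

lemma card_N_pos: "card N > 0"
  using N_zero by (auto simp: card_gt_0_iff)

text \<open>For a nonzero \<open>a\<close> in \<open>N\<close>, the map
  \<open>r \<mapsto> a * r\<close> is onto \<open>N\<close> with the cosets of \<open>N\<close> as
  fibres. Thus the ring has |N|^2 elements.\<close>

lemma card_N: "card N = q"
proof -
  obtain a where a: "a \<in> N" "a \<noteq> 0" using N_nonzero by blast
  have "(\<Sum>n\<in>N. card {r \<in> UNIV. a * r = n}) = (\<Sum>r\<in>(UNIV::'r set). 1)"
  proof (rule sum_multicount_gen)
    show "\<forall>r\<in>UNIV. card {n \<in> N. a * r = n} = 1"
    proof
      fix r
      have "{n \<in> N. a * r = n} = {a * r}" using N_mult_right[OF a(1)] by auto
      then show "card {n \<in> N. a * r = n} = 1" by simp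
    qed
  qed auto
  moreover have "card {r \<in> UNIV. a * r = n} = card N" if n: "n \<in> N" for n
  proof -
    obtain s where s: "n = a * s" using N_gen_right[OF a n] by blast
    have "a * r = n \<longleftrightarrow> r - s \<in> N" for r
      using ann_right[of a "r - s"] a N_prod[OF a(1), of "r - s"] unfolding s
      by (auto simp: right_diff_distrib)
    then show ?thesis using card_coset[of s] by simp
  qed
  ultimately have "card N * card N = q * card N" using card_quot by simp
  then show ?thesis using card_N_pos by (metis mult_right_cancel less_numeral_extra(3))
qed

lemma transversal:
  obtains T where "card T = q" "\<And>r. \<exists>t\<in>T. r - t \<in> N" "\<And>t t'. \<lbrakk>t \<in> T; t' \<in> T; t - t' \<in> N\<rbrakk> \<Longrightarrow> t = t'"
proof -
  define rep where "rep r = (SOME s. r - s \<in> N)" for r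
  have rep: "r - rep r \<in> N" for r
    unfolding rep_def by (rule someI[of _ r]) (simp add: N_zero)
  have rep_eq: "rep r = rep s" if "r - s \<in> N" for r s
  proof -
    have "r - u \<in> N \<longleftrightarrow> s - u \<in> N" for u
      using N_diff_iff[OF that, of "r - u"] by simp
    then show ?thesis unfolding rep_def by simp
  qed
  let ?T = "range rep"
  have un: "t = t'" if t: "t \<in> ?T" "t' \<in> ?T" "t - t' \<in> N" for t t'
  proof -
    obtain r s where rs: "t = rep r" "t' = rep s" using t by auto
    have "(r - rep r) + (rep r - rep s) - (s - rep s) \<in> N"
      by (rule N_diff[OF N_add[OF rep[of r] t(3)[unfolded rs]] rep[of s]])
    then show ?thesis unfolding rs by (intro rep_eq) simp
  qed
  have "(\<Sum>t\<in>?T. card {r \<in> UNIV. r - t \<in> N}) = (\<Sum>r\<in>(UNIV::'r set). 1)"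
  proof (rule sum_multicount_gen)
    show "\<forall>r\<in>UNIV. card {t \<in> ?T. r - t \<in> N} = 1"
    proof
      fix r
      have "t = rep r" if t: "t \<in> ?T" "r - t \<in> N" for t
      proof -
        have "t - rep r \<in> N" using N_diff[OF rep[of r] t(2)] by simp
        then show ?thesis using un[of t "rep r"] t by blast
      qed
      then have "{t \<in> ?T. r - t \<in> N} = {rep r}" using rep by blast
      then show "card {t \<in> ?T. r - t \<in> N} = 1" by simp
    qed
  qed auto
  then have "card ?T * card N = q * card N" using card_coset card_quot by simp
  then have "card ?T = q" using card_N_pos by (metis mult_right_cancel less_numeral_extra(3))
  then show ?thesis using that[of ?T] un rep by blast
qed

text \<open>If 1 + 1 lay in \<open>N\<close>, then either it is zero or its double, being its
  square, is zero. In both cases a nonzero element has additive order two, contradicting the odd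
  order q^2 of the ring.\<close>

lemma two_notin_N:
  assumes "odd q"
  shows "1 + 1 \<notin> N"
proof
  assume 2: "1 + 1 \<in> N"
  have odd: "odd (card (UNIV :: 'r set))" using assms card_quot card_N by simp
  show False
  proof (cases "(1::'r) + 1 = 0")
    case True
    have "(1::'r) \<noteq> 0" using one_notin_N N_zero by metis
    then show False using even_card_if_involution[of 1] True odd by blast
  next
    case False
    have "(1 + 1) + (1 + 1) = (1 + 1) * (1 + 1 :: 'r)" by (simp add: algebra_simps)
    also have "\<dots> = 0" using N_prod 2 by blast
    finally show False using even_card_if_involution[OF False] odd by blast
  qed
qed

section \<open>Vectors modulo the radical and basis exchange\<close>

text \<open>The kernel of reduction to the residue field. The other vectors have a unit coordinate;
  they are the ones that generate free submodules of rank one.\<close>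

definition small :: "'r vec3 \<Rightarrow> bool" where
  "small v \<longleftrightarrow> fst v \<in> N \<and> fst (snd v) \<in> N \<and> snd (snd v) \<in> N"

lemma small_add: "small v \<Longrightarrow> small w \<Longrightarrow> small (v + w)"
  and small_diff: "small v \<Longrightarrow> small w \<Longrightarrow> small (v - w)"
  and small_zero: "small 0"
  and small_vsmul: "small v \<Longrightarrow> small (vsmul v r)"
  and small_vsmul_N: "r \<in> N \<Longrightarrow> small (vsmul v r)"
  and small_lsm_N: "r \<in> N \<Longrightarrow> small (lsm r v)"
  by (auto simp: small_def vsmul_def lsm_def N_closed)

lemma small_dot_left: "small m \<Longrightarrow> dot m v \<in> N"
  and small_dot_right: "small v \<Longrightarrow> dot m v \<in> N"
  by (auto simp: small_def dot_def N_closed)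

lemma small_dot_small: "small m \<Longrightarrow> small v \<Longrightarrow> dot m v = 0"
  by (auto simp: small_def dot_def N_prod)

lemma db_ex:
  assumes "\<not> small x"
  shows "\<exists>y z a b c. db x y z a b c"
proof -
  obtain x1 x2 x3 where x: "x = (x1, x2, x3)" by (metis prod.exhaust)
  consider "x1 \<notin> N" | "x2 \<notin> N" | "x3 \<notin> N" using assms unfolding x small_def by auto
  then show ?thesis
  proof cases
    case 1
    have "db x (0,1,0) (0,0,1) (ri x1, 0, 0) (- x2 * ri x1, 1, 0) (- x3 * ri x1, 0, 1)"
      unfolding db_def x by (simp add: dot_def vsmul_def mult.assoc ri_left[OF 1] ri_right_assoc[OF 1])
    then show ?thesis by blast
  next
    case 2
    have "db x (1,0,0) (0,0,1) (0, ri x2, 0) (1, - x1 * ri x2, 0) (0, - x3 * ri x2, 1)"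
      unfolding db_def x by (simp add: dot_def vsmul_def mult.assoc ri_left[OF 2] ri_right_assoc[OF 2])
    then show ?thesis by blast
  next
    case 3
    have "db x (1,0,0) (0,1,0) (0, 0, ri x3) (1, 0, - x1 * ri x3) (0, 1, - x2 * ri x3)"
      unfolding db_def x by (simp add: dot_def vsmul_def mult.assoc ri_left[OF 3] ri_right_assoc[OF 3])
    then show ?thesis by blast
  qed
qed

text \<open>Steinitz exchange: \<open>u\<close> may be replaced by \<open>y\<close> when the
  \<open>u\<close>-coordinate of \<open>y\<close> is a unit, and the dual rows change by the
  matching row operations.\<close>

lemma db_exchange_col:
  assumes d: "db x u z a b c" and y: "dot b y \<notin> N"
  shows "\<exists>a b c. db x y z a b c"
proof -
  let ?w = "ri (dot b y)"
  let ?a = "a - lsm (dot a y * ?w) b" and ?b = "lsm ?w b" and ?c = "c - lsm (dot c y * ?w) b"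
  note dots = db_dots[OF d]
  have col: "v = vsmul x (dot ?a v) + vsmul y (dot ?b v) + vsmul z (dot ?c v)" for v
  proof -
    let ?s = "?w * dot b v"
    have "vsmul y ?s = vsmul x (dot a y * ?s) + vsmul u (dot b v) + vsmul z (dot c y * ?s)"
      using arg_cong[OF db_col[OF d, of y], of "\<lambda>t. vsmul t ?s"] ri_right_assoc[OF y]
      by (simp add: vec_simps)
    then have "vsmul x (dot ?a v) + vsmul y (dot ?b v) + vsmul z (dot ?c v)
        = vsmul x (dot a v) + vsmul u (dot b v) + vsmul z (dot c v)"
      by (simp add: dot_simps vec_simps mult.assoc)
    then show ?thesis using db_col[OF d, of v] by simp
  qed
  have "db x y z ?a ?b ?c" unfolding db_def
    using col by (auto simp: dot_simps dots ri_left[OF y] mult.assoc)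
  then show ?thesis by blast
qed

text \<open>The dual exchange. The third row must vanish on \<open>x\<close>, so \<open>m\<close> is
  first corrected by \<open>lsm (dot m x) a\<close>; if \<open>dot m x\<close> lies in
  \<open>N\<close>, this does not change the line class.\<close>

lemma db_exchange_row:
  assumes d: "db x u z a b c" and m: "dot m z \<notin> N"
  shows "\<exists>y z. db x y z a b (m - lsm (dot m x) a)"
proof -
  let ?w = "ri (dot m z)"
  let ?y = "u - vsmul z (?w * dot m u)" and ?z = "vsmul z ?w" and ?c = "m - lsm (dot m x) a"
  note dots = db_dots[OF d]
  have c: "dot ?c v = dot m u * dot b v + dot m z * dot c v" for v
    using arg_cong[OF db_row[OF d, of m], of "\<lambda>t. dot t v"] by (simp add: dot_simps)
  have eq: "vsmul x (dot a v) + vsmul ?y (dot b v) + vsmul ?z (dot ?c v)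
      = vsmul x (dot a v) + vsmul u (dot b v) + vsmul z (dot c v)" for v
    unfolding c using ri_left_assoc[OF m] by (simp add: dot_simps vec_simps mult.assoc distrib_left)
  have col: "v = vsmul x (dot a v) + vsmul ?y (dot b v) + vsmul ?z (dot ?c v)" for v
    by (rule trans[OF db_col[OF d, of v] eq[of v, symmetric]])
  have "db x ?y ?z a b ?c" unfolding db_def
    using col by (auto simp: dot_simps dots ri_right[OF m] ri_right_assoc[OF m])
  then show ?thesis by blast
qed

text \<open>A neighbour class of points or of lines is encoded as its full preimage under reduction
  modulo \<open>N\<close>. Incidence of classes then is set inclusion, like incidence of points and
  lines.\<close>

definition nb :: "'r vec3 \<Rightarrow> 'r vec3 set" where "nb x = {v. \<exists>r. small (v - vsmul x r)}"

definition near :: "'r vec3 \<Rightarrow> 'r vec3 set" where "near m = {v. dot m v \<in> N}"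

definition ker :: "'r vec3 \<Rightarrow> 'r vec3 set" where "ker m = {v. dot m v = 0}"

definition pt :: "'r vec3 \<Rightarrow> 'r vec3 set" where "pt x = range (vsmul x)"

lemma db_ex_row:
  assumes x: "\<not> small x" and m: "\<not> small m" "dot m x \<in> N"
  shows "\<exists>y z a b. db x y z a b (m - lsm (dot m x) a)"
proof -
  obtain y z a b c where d: "db x y z a b c" using db_ex[OF x] by blast
  have "dot m y \<notin> N \<or> dot m z \<notin> N"
  proof (rule ccontr)
    assume "\<not> ?thesis"
    then have "small (lsm (dot m x) a + lsm (dot m y) b + lsm (dot m z) c)"
      using m by (intro small_add small_lsm_N) auto
    then show False using db_row[OF d, of m] m by simp
  qed
  then show ?thesis using db_exchange_row[OF d] db_exchange_row[OF db_swap[OF d]] by blast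
qed

lemma db_ex_col:
  assumes x: "\<not> small x" and y: "y \<notin> nb x"
  shows "\<exists>z a b c. db x y z a b c"
proof -
  obtain u z a b c where d: "db x u z a b c" using db_ex[OF x] by blast
  have "dot b y \<notin> N \<or> dot c y \<notin> N"
  proof (rule ccontr)
    assume "\<not> ?thesis"
    then have "small (vsmul u (dot b y) + vsmul z (dot c y))"
      by (intro small_add small_vsmul_N) auto
    moreover have "y - vsmul x (dot a y) = vsmul u (dot b y) + vsmul z (dot c y)"
      using db_col[OF d, of y] by (simp add: algebra_simps)
    ultimately have "small (y - vsmul x (dot a y))" by simp
    then show False using y unfolding nb_def by blast
  qed
  then show ?thesis using db_exchange_col[OF d] db_exchange_col[OF db_swap[OF d]] by blast
qed

lemma db_not_small:
  assumes "db x y z a b c"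
  shows "\<not> small x" "\<not> small y" "\<not> small z" "\<not> small a" "\<not> small b" "\<not> small c"
  using db_dots[OF assms] one_notin_N small_dot_right[of x a] small_dot_right[of y b] small_dot_right[of z c]
    small_dot_left[of a x] small_dot_left[of b y] small_dot_left[of c z] by auto

lemma near_cong:
  assumes "small (m - lsm r m')" "r \<notin> N"
  shows "near m = near m'"
proof -
  have "dot m v \<in> N \<longleftrightarrow> dot m' v \<in> N" for v
  proof -
    have "dot m v - r * dot m' v \<in> N" using small_dot_left[OF assms(1), of v] by (simp add: dot_simps)
    then have "dot m v \<in> N \<longleftrightarrow> r * dot m' v \<in> N"
      by (rule N_cong)
    then show ?thesis using unit_mult_in_N[OF assms(2)] by simp
  qed
  then show ?thesis unfolding near_def by simp
qed

lemma ker_lsm: "r \<notin> N \<Longrightarrow> ker (lsm r m) = ker m"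
  unfolding ker_def dot_lsm using ri_left_assoc[of r] by (auto dest: arg_cong[of _ _ "(*) (ri r)"])

lemma nb_sub:
  assumes "v \<in> nb w"
  shows "nb v \<subseteq> nb w"
proof
  fix u assume "u \<in> nb v"
  then obtain s where s: "small (u - vsmul v s)" unfolding nb_def by auto
  obtain r where r: "small (v - vsmul w r)" using assms unfolding nb_def by auto
  have "small ((u - vsmul v s) + vsmul (v - vsmul w r) s)" using s r by (intro small_add small_vsmul)
  then show "u \<in> nb w" unfolding nb_def by (auto simp: vec_simps)
qed

lemma nb_eqI:
  assumes v: "\<not> small v" "v \<in> nb w"
  shows "nb v = nb w"
proof
  obtain r where r: "small (v - vsmul w r)" using v unfolding nb_def by auto
  have rN: "r \<notin> N" using r small_vsmul_N small_add v(1) by (metis diff_add_cancel)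
  have "small (vsmul (v - vsmul w r) (- ri r))" using r by (intro small_vsmul)
  moreover have "vsmul (v - vsmul w r) (- ri r) = w - vsmul v (ri r)"
    using ri_right[OF rN] vsmul_diff[of "v - vsmul w r" 0 "ri r"] by (simp add: vec_simps)
  ultimately have "w \<in> nb v" unfolding nb_def by auto
  then show "nb w \<subseteq> nb v" by (rule nb_sub)
qed (rule nb_sub[OF v(2)])

lemma self_in_nb: "x \<in> nb x"
proof -
  have "small (x - vsmul x 1)" by (simp add: vsmul_one small_zero)
  then show ?thesis unfolding nb_def by blast
qed

lemma nb_sub_near: "nb x \<subseteq> near m \<longleftrightarrow> dot m x \<in> N"
proof
  assume "nb x \<subseteq> near m"
  then show "dot m x \<in> N" using self_in_nb[of x] unfolding near_def by blast
next
  assume m: "dot m x \<in> N"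
  show "nb x \<subseteq> near m"
  proof
    fix v assume "v \<in> nb x"
    then obtain r where "small (v - vsmul x r)" unfolding nb_def by auto
    then have "dot m v - dot m x * r \<in> N" using small_dot_right[of "v - vsmul x r" m] by (simp add: dot_simps)
    then show "v \<in> near m" unfolding near_def using N_diff_iff[OF N_mult_right[OF m]] by simp
  qed
qed

lemma pt_sub_ker: "pt x \<subseteq> ker m \<longleftrightarrow> dot m x = 0"
proof
  assume "pt x \<subseteq> ker m"
  moreover have "vsmul x 1 \<in> pt x" unfolding pt_def by blast
  ultimately show "dot m x = 0" unfolding ker_def vsmul_one by blast
qed (auto simp: pt_def ker_def dot_simps)

lemma pt_vsmul:
  assumes "r \<notin> N"
  shows "pt (vsmul x r) = pt x"
proof -
  have eq: "vsmul x s = vsmul (vsmul x r) (ri r * s)" for s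
    using ri_right_assoc[OF assms] by (simp add: vec_simps)
  have "pt x \<subseteq> pt (vsmul x r)" unfolding pt_def using eq by blast
  moreover have "pt (vsmul x r) \<subseteq> pt x" unfolding pt_def vsmul_assoc by blast
  ultimately show ?thesis by blast
qed

lemma row_kernel_ex:
  assumes "\<not> small m"
  shows "\<exists>x. \<not> small x \<and> dot m x = 0"
proof -
  obtain m1 m2 m3 where m: "m = (m1, m2, m3)" by (metis prod.exhaust)
  consider "m1 \<notin> N" | "m2 \<notin> N" | "m3 \<notin> N" using assms unfolding m small_def by auto
  then show ?thesis
  proof cases
    case 1
    then show ?thesis using one_notin_N
      by (intro exI[of _ "(- ri m1 * m2, 1, 0)"]) (simp add: m dot_def small_def ri_right_assoc)
  next
    case 2
    then show ?thesis using one_notin_N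
      by (intro exI[of _ "(1, - ri m2 * m1, 0)"]) (simp add: m dot_def small_def ri_right_assoc)
  next
    case 3
    then show ?thesis using one_notin_N
      by (intro exI[of _ "(1, 0, - ri m3 * m1)"]) (simp add: m dot_def small_def ri_right_assoc)
  qed
qed

lemma db_ex_kernel:
  assumes "\<not> small m" "\<not> small x" "dot m x = 0"
  shows "\<exists>y z a b. db x y z a b m"
  using db_ex_row[OF assms(2,1)] assms(3) N_zero by (simp add: vec_simps)

lemma db_ex_for_row:
  assumes "\<not> small m"
  shows "\<exists>x y z a b. db x y z a b m"
  using row_kernel_ex[OF assms] db_ex_kernel[OF assms] by blast

text \<open>Completing \<open>m\<close> to a dual basis exhibits the kernel as freely spanned by
  \<open>x\<close> and \<open>y\<close>. This makes the arc condition, stated for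
  \<open>hlines\<close>, available for kernels.\<close>

lemma ker_in_hlines:
  assumes "\<not> small m"
  shows "ker m \<in> hlines"
proof -
  obtain x y z a b where d: "db x y z a b m" using db_ex_for_row[OF assms] by blast
  have "ker m = {vadd (vsmul x r) (vsmul y s) | r s. True}"
  proof
    show "ker m \<subseteq> {vadd (vsmul x r) (vsmul y s) | r s. True}"
    proof
      fix v assume "v \<in> ker m"
      then have "v = vadd (vsmul x (dot a v)) (vsmul y (dot b v))"
        using db_col[OF d, of v] unfolding ker_def by (simp add: vadd_eq_plus vec_simps)
      then show "v \<in> {vadd (vsmul x r) (vsmul y s) | r s. True}" by blast
    qed
  qed (auto simp: ker_def vadd_eq_plus dot_simps db_dots[OF d])
  moreover have "r = 0 \<and> s = 0" if h: "vadd (vsmul x r) (vsmul y s) = (0, 0, 0)" for r s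
  proof -
    have "dot t (vadd (vsmul x r) (vsmul y s)) = 0" for t unfolding h by (simp add: dot_def)
    from this[of a] this[of b] show ?thesis by (simp add: vadd_eq_plus dot_simps db_dots[OF d])
  qed
  ultimately show ?thesis unfolding hlines_def by blast
qed

text \<open>A generator with all coordinates in \<open>N\<close> would be annihilated by
  \<open>N\<close>, so its span could not be free.\<close>

lemma hpoint_rep:
  assumes "P \<in> hpoints"
  obtains x where "\<not> small x" "P = pt x"
proof -
  obtain x where x: "P = {vsmul x r | r. True}" "\<And>r. vsmul x r = (0,0,0) \<Longrightarrow> r = 0"
    using assms unfolding hpoints_def by blast
  obtain n where n: "n \<in> N" "n \<noteq> 0" using N_nonzero by blast
  have "\<not> small x"
  proof
    assume "small x"
    then have "vsmul x n = (0,0,0)" using n N_prod by (simp add: small_def vsmul_def)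
    then show False using x(2) n by blast
  qed
  moreover have "P = pt x" unfolding x pt_def by auto
  ultimately show ?thesis using that by blast
qed

lemma pt_hpoint:
  assumes "\<not> small x"
  shows "pt x \<in> hpoints"
proof -
  obtain y z a b c where d: "db x y z a b c" using db_ex[OF assms] by blast
  have "r = 0" if h: "vsmul x r = (0,0,0)" for r
  proof -
    have "dot a (vsmul x r) = 0" unfolding h by (simp add: dot_def)
    then show ?thesis by (simp add: dot_simps db_dots[OF d])
  qed
  moreover have "pt x = {vsmul x r | r. True}" unfolding pt_def by auto
  ultimately show ?thesis unfolding hpoints_def by blast
qed

definition pcl :: "'r vec3 set \<Rightarrow> 'r vec3 set" where "pcl P = {v. \<exists>u\<in>P. small (v - u)}"

definition PC :: "'r vec3 set set" where "PC = {nb x | x. \<not> small x}"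

definition LC :: "'r vec3 set set" where "LC = {near m | m. \<not> small m}"

definition Ln :: "'r vec3 set \<Rightarrow> 'r vec3 set set" where
  "Ln L = {ker m | m. \<not> small m \<and> near m = L}"

lemma nb_in_PC: "\<not> small x \<Longrightarrow> nb x \<in> PC"
  and near_in_LC: "\<not> small m \<Longrightarrow> near m \<in> LC"
  and ker_in_Ln: "\<not> small m \<Longrightarrow> near m = L \<Longrightarrow> ker m \<in> Ln L"
  unfolding PC_def LC_def Ln_def by blast+

lemma pcl_pt: "pcl (pt x) = nb x"
  unfolding pcl_def pt_def nb_def by auto

lemma near_eq_rep:
  assumes m: "\<not> small m" "\<not> small m'" "near m = near m'"
  shows "\<exists>r. r \<notin> N \<and> small (m' - lsm r m)"
proof -
  obtain x y z a b where d: "db x y z a b m" using db_ex_for_row[OF m(1)] by blast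
  have "x \<in> near m" "y \<in> near m" unfolding near_def using db_dots[OF d] N_zero by auto
  then have N: "dot m' x \<in> N" "dot m' y \<in> N" using m(3) unfolding near_def by auto
  then have s: "small (lsm (dot m' x) a + lsm (dot m' y) b)" by (intro small_add small_lsm_N)
  moreover have eq: "m' - lsm (dot m' z) m = lsm (dot m' x) a + lsm (dot m' y) b"
    using db_row[OF d, of m'] by (simp add: algebra_simps)
  moreover have "dot m' z \<notin> N"
  proof
    assume "dot m' z \<in> N"
    then have "small ((m' - lsm (dot m' z) m) + lsm (dot m' z) m)"
      unfolding eq by (intro small_add[OF s] small_lsm_N)
    then show False using m(2) by simp
  qed
  ultimately show ?thesis by (metis (no_types))
qed

text \<open>Rows of one line class differ by a scalar factor and a small row, and small rows kill
  small vectors since products in \<open>N\<close> vanish. Hence the direction of a small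
  displacement depends on the line class only.\<close>

lemma same_class_dot_zero:
  assumes "\<not> small m" "\<not> small m'" "near m = near m'" "small n" "dot m n = 0"
  shows "dot m' n = 0"
proof -
  obtain r where r: "small (m' - lsm r m)" using near_eq_rep[OF assms(1-3)] by blast
  have "dot (m' - lsm r m) n = 0" by (rule small_dot_small[OF r assms(4)])
  then show ?thesis using assms(5) by (simp add: dot_simps)
qed

lemma near_eqI:
  assumes d: "db x y z a b c" and m: "\<not> small m" "dot m x \<in> N" "dot m y \<in> N"
  shows "near m = near c" "dot m z \<notin> N"
proof -
  have s: "small (lsm (dot m x) a + lsm (dot m y) b)" using m by (intro small_add small_lsm_N)
  have eq: "m - lsm (dot m z) c = lsm (dot m x) a + lsm (dot m y) b"
    using db_row[OF d, of m] by (simp add: algebra_simps)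
  show z: "dot m z \<notin> N"
  proof
    assume "dot m z \<in> N"
    then have "small ((m - lsm (dot m z) c) + lsm (dot m z) c)"
      unfolding eq by (intro small_add[OF s] small_lsm_N)
    then show False using m(1) by simp
  qed
  show "near m = near c" by (rule near_cong[OF _ z]) (simp add: eq s)
qed

lemma ker_eqI:
  assumes d: "db x y z a b c" and m: "\<not> small m" "dot m x = 0" "dot m y = 0"
  shows "ker m = ker c"
proof -
  have "m = lsm (dot m z) c" using db_row[OF d, of m] m by (simp add: vec_simps)
  moreover have "dot m z \<notin> N" using near_eqI(2)[OF d m(1)] m N_zero by simp
  ultimately show ?thesis using ker_lsm by metis
qed

lemma card_insert_image_transversal:
  assumes "card T = q" "inj_on f T" "k \<notin> f ` T"
  shows "card (insert k (f ` T)) = q + 1"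
  using assms card_image[OF assms(2)] q_ge_5 by (simp add: card_ge_0_finite)

section \<open>Verification of the plane axioms\<close>

text \<open>Modulo \<open>N\<close>, the rows vanishing at \<open>x\<close> form the span of
  \<open>b\<close> and \<open>c\<close>; its points are \<open>b\<close> and the rows
  \<open>c + lsm t b\<close> with \<open>t\<close> from a transversal of the residues.\<close>

lemma card_line_classes:
  assumes X: "X \<in> PC"
  shows "card {L \<in> LC. X \<subseteq> L} = q + 1"
proof -
  obtain x where x: "\<not> small x" "X = nb x" using X unfolding PC_def by blast
  obtain y z a b c where d: "db x y z a b c" using db_ex[OF x(1)] by blast
  note dots = db_dots[OF d]
  obtain T where T: "card T = q" "\<And>r. \<exists>t\<in>T. r - t \<in> N"
    "\<And>t t'. \<lbrakk>t \<in> T; t' \<in> T; t - t' \<in> N\<rbrakk> \<Longrightarrow> t = t'" using transversal by blast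
  let ?f = "\<lambda>t. near (c + lsm t b)"
  have ns: "\<not> small (c + lsm t b)" for t
  proof
    assume "small (c + lsm t b)"
    from small_dot_left[OF this, of z] show False using one_notin_N by (simp add: dot_simps dots)
  qed
  have eq: "{L \<in> LC. X \<subseteq> L} = insert (near b) (?f ` T)"
  proof
    have "near b \<in> LC \<and> X \<subseteq> near b"
      unfolding x(2) nb_sub_near using near_in_LC[OF db_not_small(5)[OF d]] dots N_zero by simp
    moreover have "?f t \<in> LC \<and> X \<subseteq> ?f t" for t
      unfolding x(2) nb_sub_near using near_in_LC[OF ns] dots N_zero by (simp add: dot_simps)
    ultimately show "insert (near b) (?f ` T) \<subseteq> {L \<in> LC. X \<subseteq> L}" by blast
    show "{L \<in> LC. X \<subseteq> L} \<subseteq> insert (near b) (?f ` T)"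
    proof
      fix L assume "L \<in> {L \<in> LC. X \<subseteq> L}"
      then obtain m where m: "\<not> small m" "L = near m" "dot m x \<in> N"
        unfolding LC_def x(2) by (auto simp: nb_sub_near)
      show "L \<in> insert (near b) (?f ` T)"
      proof (cases "dot m z \<in> N")
        case True
        then show ?thesis using near_eqI(1)[OF db_swap[OF d] m(1,3)] m by simp
      next
        case False
        obtain t where t: "t \<in> T" "ri (dot m z) * dot m y - t \<in> N" using T(2) by blast
        have "dot m z * (ri (dot m z) * dot m y - t) \<in> N" using t by (intro N_mult_left)
        then have n: "dot m y - dot m z * t \<in> N"
          by (simp add: right_diff_distrib ri_right_assoc[OF False])
        have "m - lsm (dot m z) (c + lsm t b) = lsm (dot m x) a + lsm (dot m y - dot m z * t) b"
          using db_row[OF d, of m] by (simp add: vec_simps algebra_simps)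
        then have "small (m - lsm (dot m z) (c + lsm t b))"
          using n m by (simp add: small_add small_lsm_N)
        from near_cong[OF this False] show ?thesis using t m by blast
      qed
    qed
  qed
  have inj: "inj_on ?f T"
  proof (rule inj_onI)
    fix t t' assume t: "t \<in> T" "t' \<in> T" "?f t = ?f t'"
    have "y - vsmul z t' \<in> ?f t'" unfolding near_def using N_zero by (simp add: dot_simps dots)
    then have "y - vsmul z t' \<in> ?f t" using t by simp
    then have "t - t' \<in> N" unfolding near_def by (simp add: dot_simps dots)
    then show "t = t'" using T(3) t by blast
  qed
  have "near b \<notin> ?f ` T"
  proof
    assume "near b \<in> ?f ` T"
    then obtain t where t: "near b = ?f t" by blast
    have "z \<in> near b" unfolding near_def using N_zero dots by simp
    then have "z \<in> ?f t" using t by simp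
    then show False unfolding near_def using one_notin_N by (simp add: dot_simps dots)
  qed
  then show ?thesis unfolding eq by (rule card_insert_image_transversal[OF T(1) inj])
qed

lemma card_point_classes:
  assumes L: "L \<in> LC"
  shows "card {X \<in> PC. X \<subseteq> L} = q + 1"
proof -
  obtain m where m: "\<not> small m" "L = near m" using L unfolding LC_def by blast
  obtain x y z a b where d: "db x y z a b m" using db_ex_for_row[OF m(1)] by blast
  note dots = db_dots[OF d]
  obtain T where T: "card T = q" "\<And>r. \<exists>t\<in>T. r - t \<in> N"
    "\<And>t t'. \<lbrakk>t \<in> T; t' \<in> T; t - t' \<in> N\<rbrakk> \<Longrightarrow> t = t'" using transversal by blast
  let ?f = "\<lambda>t. nb (x + vsmul y t)"
  have ns: "\<not> small (x + vsmul y t)" for t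
  proof
    assume "small (x + vsmul y t)"
    from small_dot_right[OF this, of a] show False using one_notin_N by (simp add: dot_simps dots)
  qed
  have eq: "{X \<in> PC. X \<subseteq> L} = insert (nb y) (?f ` T)"
  proof
    have "nb y \<in> PC \<and> nb y \<subseteq> L"
      unfolding m(2) nb_sub_near using nb_in_PC[OF db_not_small(2)[OF d]] dots N_zero by simp
    moreover have "?f t \<in> PC \<and> ?f t \<subseteq> L" for t
      unfolding m(2) nb_sub_near using nb_in_PC[OF ns] dots N_zero by (simp add: dot_simps)
    ultimately show "insert (nb y) (?f ` T) \<subseteq> {X \<in> PC. X \<subseteq> L}" by blast
    show "{X \<in> PC. X \<subseteq> L} \<subseteq> insert (nb y) (?f ` T)"
    proof
      fix X assume "X \<in> {X \<in> PC. X \<subseteq> L}"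
      then obtain v where v: "\<not> small v" "X = nb v" "dot m v \<in> N"
        unfolding PC_def m(2) by (auto simp: nb_sub_near)
      show "X \<in> insert (nb y) (?f ` T)"
      proof (cases "dot a v \<in> N")
        case True
        have "v - vsmul y (dot b v) = vsmul x (dot a v) + vsmul z (dot m v)"
          using db_col[OF d, of v] by (simp add: algebra_simps)
        moreover have "small (vsmul x (dot a v) + vsmul z (dot m v))"
          using True v by (intro small_add small_vsmul_N)
        ultimately have "small (v - vsmul y (dot b v))" by simp
        then have "v \<in> nb y" unfolding nb_def by blast
        then show ?thesis using nb_eqI[OF v(1)] v(2) by simp
      next
        case False
        obtain t where t: "t \<in> T" "dot b v * ri (dot a v) - t \<in> N" using T(2) by blast
        have "(dot b v * ri (dot a v) - t) * dot a v \<in> N" using t by (intro N_mult_right)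
        then have n: "dot b v - t * dot a v \<in> N"
          by (simp add: left_diff_distrib mult.assoc ri_left[OF False])
        have "v - vsmul (x + vsmul y t) (dot a v) = vsmul y (dot b v - t * dot a v) + vsmul z (dot m v)"
          using db_col[OF d, of v] by (simp add: vec_simps algebra_simps)
        moreover have "small (vsmul y (dot b v - t * dot a v) + vsmul z (dot m v))"
          using n v by (intro small_add small_vsmul_N)
        ultimately have "small (v - vsmul (x + vsmul y t) (dot a v))" by simp
        then have "v \<in> ?f t" unfolding nb_def by blast
        then show ?thesis using nb_eqI[OF v(1)] v(2) t by simp
      qed
    qed
  qed
  have inj: "inj_on ?f T"
  proof (rule inj_onI)
    fix t t' assume t: "t \<in> T" "t' \<in> T" "?f t = ?f t'"
    have "x + vsmul y t \<in> ?f t'" using t(3) self_in_nb by blast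
    then obtain r where r: "small (x + vsmul y t - vsmul (x + vsmul y t') r)" unfolding nb_def by blast
    have "1 - r \<in> N" using small_dot_right[OF r, of a] by (simp add: dot_simps dots)
    then have 1: "t' * (1 - r) \<in> N" by (rule N_mult_left)
    have "t - t' * r \<in> N" using small_dot_right[OF r, of b] by (simp add: dot_simps dots)
    then have "(t - t' * r) - t' * (1 - r) \<in> N" using 1 by (rule N_diff)
    then have "t - t' \<in> N" by (simp add: algebra_simps)
    then show "t = t'" using T(3) t by blast
  qed
  have "nb y \<notin> ?f ` T"
  proof
    assume "nb y \<in> ?f ` T"
    then obtain t where t: "nb y = ?f t" by blast
    have "x + vsmul y t \<in> nb y" using t self_in_nb by blast
    then obtain r where r: "small (x + vsmul y t - vsmul y r)" unfolding nb_def by blast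
    show False using small_dot_right[OF r, of a] one_notin_N by (simp add: dot_simps dots)
  qed
  then show ?thesis unfolding eq by (rule card_insert_image_transversal[OF T(1) inj])
qed

lemma class_join_ex1:
  assumes X: "X \<in> PC" and Y: "Y \<in> PC" and ne: "X \<noteq> Y"
  shows "\<exists>!L. L \<in> LC \<and> X \<subseteq> L \<and> Y \<subseteq> L"
proof -
  obtain x where x: "\<not> small x" "X = nb x" using X unfolding PC_def by blast
  obtain y where y: "\<not> small y" "Y = nb y" using Y unfolding PC_def by blast
  have "y \<notin> nb x" using nb_eqI[OF y(1), of x] ne x y by blast
  then obtain z a b c where d: "db x y z a b c" using db_ex_col[OF x(1)] by blast
  note dots = db_dots[OF d]
  show ?thesis
  proof (rule ex1I[of _ "near c"])
    show "near c \<in> LC \<and> X \<subseteq> near c \<and> Y \<subseteq> near c"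
      unfolding x(2) y(2) nb_sub_near using near_in_LC[OF db_not_small(6)[OF d]] dots N_zero by simp
    fix L assume "L \<in> LC \<and> X \<subseteq> L \<and> Y \<subseteq> L"
    then obtain m where "\<not> small m" "L = near m" "dot m x \<in> N" "dot m y \<in> N"
      unfolding LC_def x(2) y(2) by (auto simp: nb_sub_near)
    then show "L = near c" using near_eqI(1)[OF d] by blast
  qed
qed

lemma db_for_flag:
  assumes x: "\<not> small x" and L: "L \<in> LC" "nb x \<subseteq> L"
  obtains y z a b c where "db x y z a b c" "near c = L"
proof -
  obtain m where m: "\<not> small m" "L = near m" "dot m x \<in> N"
    using L unfolding LC_def by (auto simp: nb_sub_near)
  obtain y z a b where d: "db x y z a b (m - lsm (dot m x) a)" using db_ex_row[OF x m(1,3)] by blast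
  have "small (m - lsm 1 (m - lsm (dot m x) a))" using m(3) by (simp add: vec_simps small_lsm_N)
  from near_cong[OF this one_notin_N] show ?thesis using that[OF d] m(2) by simp
qed

text \<open>Within a fixed line class, a row vanishing at \<open>x\<close> can be scaled to
  \<open>c + lsm n b\<close> with \<open>n\<close> in \<open>N\<close>, and \<open>n\<close> is
  determined by the kernel.\<close>

lemma card_lines_through:
  assumes L: "L \<in> LC" and P: "P \<in> hpoints" "pcl P \<subseteq> L"
  shows "card {l \<in> Ln L. P \<subseteq> l} = q"
proof -
  obtain x where x: "\<not> small x" "P = pt x" using hpoint_rep[OF P(1)] by blast
  obtain y z a b c where d: "db x y z a b c" and c: "near c = L"
    using db_for_flag[OF x(1) L] P(2) unfolding x(2) pcl_pt by blast
  note dots = db_dots[OF d]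
  let ?f = "\<lambda>n. ker (c + lsm n b)"
  have "{l \<in> Ln L. P \<subseteq> l} = ?f ` N"
  proof
    show "?f ` N \<subseteq> {l \<in> Ln L. P \<subseteq> l}"
    proof
      fix l assume "l \<in> ?f ` N"
      then obtain n where n: "n \<in> N" "l = ?f n" by blast
      have "\<not> small (c + lsm n b)"
      proof
        assume "small (c + lsm n b)"
        from small_dot_left[OF this, of z] show False using one_notin_N by (simp add: dot_simps dots)
      qed
      moreover have "near (c + lsm n b) = near c"
        by (rule near_cong[OF _ one_notin_N]) (simp add: vec_simps small_lsm_N[OF n(1)])
      ultimately have "l \<in> Ln L" unfolding n(2) using ker_in_Ln c by blast
      moreover have "P \<subseteq> l" unfolding n(2) x(2) pt_sub_ker by (simp add: dot_simps dots)
      ultimately show "l \<in> {l \<in> Ln L. P \<subseteq> l}" by blast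
    qed
    show "{l \<in> Ln L. P \<subseteq> l} \<subseteq> ?f ` N"
    proof
      fix l assume "l \<in> {l \<in> Ln L. P \<subseteq> l}"
      then obtain m where m: "\<not> small m" "near m = L" "l = ker m" "dot m x = 0"
        unfolding Ln_def x(2) by (auto simp: pt_sub_ker)
      have "y \<in> near c" unfolding near_def using dots N_zero by simp
      then have my: "dot m y \<in> N" using c m(2) unfolding near_def by blast
      have mz: "dot m z \<notin> N" using near_eqI(2)[OF d m(1)] m(4) my N_zero by simp
      have "m = lsm (dot m z) (c + lsm (ri (dot m z) * dot m y) b)"
        using db_row[OF d, of m] m(4) by (simp add: vec_simps ri_right_assoc[OF mz] add.commute)
      then have "l = ker (c + lsm (ri (dot m z) * dot m y) b)" using ker_lsm[OF mz] m(3) by metis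
      then show "l \<in> ?f ` N" using N_mult_left[OF my] by blast
    qed
  qed
  moreover have "inj_on ?f N"
  proof (rule inj_onI)
    fix n n' assume n: "?f n = ?f n'"
    have "y - vsmul z n' \<in> ?f n'" unfolding ker_def by (simp add: dot_simps dots)
    then have "y - vsmul z n' \<in> ?f n" using n by simp
    then show "n = n'" unfolding ker_def by (simp add: dot_simps dots)
  qed
  ultimately show ?thesis using card_image card_N by metis
qed

lemma line_join_ex1:
  assumes L: "L \<in> LC" and P: "P \<in> hpoints" "P' \<in> hpoints" "pcl P \<subseteq> L" "pcl P' \<subseteq> L" "pcl P \<noteq> pcl P'"
  shows "\<exists>!l. l \<in> Ln L \<and> P \<subseteq> l \<and> P' \<subseteq> l"
proof -
  obtain x where x: "\<not> small x" "P = pt x" using hpoint_rep[OF P(1)] by blast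
  obtain y where y: "\<not> small y" "P' = pt y" using hpoint_rep[OF P(2)] by blast
  have "y \<notin> nb x" using nb_eqI[OF y(1), of x] P(5) unfolding x y pcl_pt by blast
  then obtain z a b c where d: "db x y z a b c" using db_ex_col[OF x(1)] by blast
  note dots = db_dots[OF d]
  obtain m where m: "\<not> small m" "L = near m" using L unfolding LC_def by blast
  have "dot m x \<in> N" "dot m y \<in> N" using P(3,4) unfolding m(2) x(2) y(2) pcl_pt nb_sub_near by auto
  then have cL: "near c = L" using near_eqI(1)[OF d m(1)] m by simp
  show ?thesis
  proof (rule ex1I[of _ "ker c"])
    show "ker c \<in> Ln L \<and> P \<subseteq> ker c \<and> P' \<subseteq> ker c"
      unfolding x(2) y(2) pt_sub_ker using ker_in_Ln[OF db_not_small(6)[OF d] cL] dots by simp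
    fix l assume "l \<in> Ln L \<and> P \<subseteq> l \<and> P' \<subseteq> l"
    then obtain k where "\<not> small k" "l = ker k" "dot k x = 0" "dot k y = 0"
      unfolding Ln_def x(2) y(2) by (auto simp: pt_sub_ker)
    then show "l = ker c" using ker_eqI[OF d] by blast
  qed
qed

text \<open>Up to scaling, neighbouring points differ by a small vector; for those
  \<open>same_class_dot_zero\<close> passes from one line of the class to the other.\<close>

lemma segment_rigid:
  assumes l: "l \<in> Ln L" "l' \<in> Ln L" and P: "P \<in> hpoints" "P' \<in> hpoints" "pcl P = pcl P'"
    and inc: "P \<subseteq> l" "P' \<subseteq> l" "P \<subseteq> l'"
  shows "P' \<subseteq> l'"
proof -
  obtain x where x: "\<not> small x" "P = pt x" using hpoint_rep[OF P(1)] by blast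
  obtain y where y: "\<not> small y" "P' = pt y" using hpoint_rep[OF P(2)] by blast
  obtain m where m: "\<not> small m" "l = ker m" "near m = L" using l unfolding Ln_def by blast
  obtain m' where m': "\<not> small m'" "l' = ker m'" "near m' = L" using l unfolding Ln_def by blast
  have "y \<in> nb x" using P(3) self_in_nb[of y] unfolding x y pcl_pt by simp
  then obtain r where r: "small (y - vsmul x r)" unfolding nb_def by blast
  have z: "dot m x = 0" "dot m y = 0" "dot m' x = 0" using inc unfolding x y m m' pt_sub_ker by auto
  then have "dot m (y - vsmul x r) = 0" by (simp add: dot_simps)
  then have "dot m' (y - vsmul x r) = 0" using same_class_dot_zero[OF m(1) m'(1) _ r] m m' by simp
  then show ?thesis unfolding y m' pt_sub_ker using z by (simp add: dot_simps)
qed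

lemma normal_rep:
  assumes P: "P \<in> hpoints" "pcl P = nb x"
  obtains n where "small n" "P = pt (x + n)"
proof -
  obtain y where y: "\<not> small y" "P = pt y" using hpoint_rep[OF P(1)] by blast
  have "y \<in> nb x" using P(2) self_in_nb[of y] unfolding y pcl_pt by simp
  then obtain r where r: "small (y - vsmul x r)" unfolding nb_def by blast
  have rN: "r \<notin> N"
  proof
    assume "r \<in> N"
    then have "small ((y - vsmul x r) + vsmul x r)" using r by (intro small_add small_vsmul_N)
    then show False using y(1) by simp
  qed
  have "vsmul y (ri r) = x + vsmul (y - vsmul x r) (ri r)"
    by (simp add: vec_simps ri_right[OF rN])
  then have "P = pt (x + vsmul (y - vsmul x r) (ri r))"
    using pt_vsmul[OF ri_notin_N[OF rN], of y] y(2) by simp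
  then show ?thesis using that small_vsmul[OF r] by blast
qed

text \<open>For a row vanishing at \<open>x\<close>, incidence with \<open>P'\<close> is one linear
  equation in its two other coordinates, with coefficients in \<open>N\<close> that are not both
  zero. As \<open>N\<close> is one-dimensional over the residue field, the solution is unique up to
  a factor modulo \<open>N\<close>.\<close>

lemma direction_ex1:
  assumes P: "P \<in> hpoints" "P' \<in> hpoints" "pcl P = pcl P'" "P \<noteq> P'"
  shows "\<exists>!L. L \<in> LC \<and> (\<exists>l\<in>Ln L. P \<subseteq> l \<and> P' \<subseteq> l)"
proof -
  obtain x where x: "\<not> small x" "P = pt x" using hpoint_rep[OF P(1)] by blast
  have "pcl P' = nb x" using P(3) x(2) pcl_pt by simp
  then obtain n where n: "small n" "P' = pt (x + n)" using normal_rep[OF P(2)] by blast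
  obtain y z a b c where d: "db x y z a b c" using db_ex[OF x(1)] by blast
  note dots = db_dots[OF d]
  let ?u = "dot b n" and ?v = "dot c n"
  have N: "dot a n \<in> N" "?u \<in> N" "?v \<in> N" using n small_dot_right by auto
  have ne: "?u \<noteq> 0 \<or> ?v \<noteq> 0"
  proof (rule ccontr)
    assume "\<not> ?thesis"
    then have "n = vsmul x (dot a n)" using db_col[OF d, of n] by (simp add: vec_simps)
    then have "x + n = vsmul x (1 + dot a n)" by (simp add: vec_simps)
    moreover have "1 + dot a n \<notin> N" using N_diff[OF _ N(1), of "1 + dot a n"] one_notin_N by auto
    ultimately show False using pt_vsmul P(4) x n by metis
  qed
  have line: "dot m n = dot m y * ?u + dot m z * ?v" if "dot m x = 0" for m
    using arg_cong[OF db_row[OF d, of m], of "\<lambda>t. dot t n"] that by (simp add: dot_simps)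
  have "\<exists>k. \<not> small k \<and> dot k x = 0 \<and> dot k n = 0 \<and>
      (\<forall>m. \<not> small m \<and> dot m x = 0 \<and> dot m n = 0 \<longrightarrow> near m = near k)"
  proof (cases "?u = 0")
    case True
    have "near m = near b" if m: "\<not> small m" "dot m x = 0" "dot m n = 0" for m
    proof -
      have "dot m z * ?v = 0" using line[OF m(2)] m(3) True by simp
      then have "dot m z \<in> N" using ann_left ne True by blast
      then show ?thesis using near_eqI(1)[OF db_swap[OF d] m(1)] m(2) N_zero by simp
    qed
    then show ?thesis using db_not_small(5)[OF d] dots True by blast
  next
    case False
    \<comment> \<open>The ratio of the two coefficients exists because a nonzero element generates
      \<open>N\<close>; it is the slope of the direction row \<open>?k\<close>.\<close>
    obtain r where r: "?v = r * ?u" using N_gen_left[OF N(2) False N(3)] by blast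
    let ?k = "c - lsm r b"
    have ns: "\<not> small ?k"
    proof
      assume "small ?k"
      from small_dot_left[OF this, of z] show False using one_notin_N by (simp add: dot_simps dots)
    qed
    have "near m = near ?k" if m: "\<not> small m" "dot m x = 0" "dot m n = 0" for m
    proof -
      have "(dot m y + dot m z * r) * ?u = 0" using line[OF m(2)] m(3) r by (simp add: distrib_right mult.assoc)
      then have N1: "dot m y + dot m z * r \<in> N" using ann_left False by blast
      have "dot m z \<notin> N"
      proof
        assume z: "dot m z \<in> N"
        have "dot m y \<in> N" using N_diff[OF N1 N_mult_right[OF z, of r]] by simp
        then show False using near_eqI(2)[OF d m(1)] m(2) z N_zero by simp
      qed
      moreover have "m - lsm (dot m z) ?k = lsm (dot m y + dot m z * r) b"
        using db_row[OF d, of m] m(2) by (simp add: vec_simps algebra_simps)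
      ultimately show ?thesis using near_cong[of m "dot m z" ?k] small_lsm_N[OF N1] by simp
    qed
    moreover have "dot ?k x = 0" "dot ?k n = 0" using r by (simp_all add: dot_simps dots)
    ultimately show ?thesis using ns by blast
  qed
  then obtain k where k: "\<not> small k" "dot k x = 0" "dot k n = 0"
    and uniq: "\<And>m. \<lbrakk>\<not> small m; dot m x = 0; dot m n = 0\<rbrakk> \<Longrightarrow> near m = near k" by blast
  show ?thesis
  proof (rule ex1I[of _ "near k"])
    have "ker k \<in> Ln (near k)" unfolding Ln_def using k by blast
    moreover have "P \<subseteq> ker k" "P' \<subseteq> ker k" unfolding x(2) n(2) pt_sub_ker using k by (auto simp: dot_simps)
    ultimately show "near k \<in> LC \<and> (\<exists>l\<in>Ln (near k). P \<subseteq> l \<and> P' \<subseteq> l)"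
      unfolding LC_def using k by blast
    fix L assume "L \<in> LC \<and> (\<exists>l\<in>Ln L. P \<subseteq> l \<and> P' \<subseteq> l)"
    then obtain m where m: "\<not> small m" "near m = L" "dot m x = 0" "dot m (x + n) = 0"
      unfolding Ln_def x(2) n(2) by (auto simp: pt_sub_ker)
    then have "dot m n = 0" by (simp add: dot_simps)
    then show "L = near k" using uniq[OF m(1,3)] m(2) by simp
  qed
qed

lemma line_meet_ex:
  assumes l: "l \<in> Ln L" "l' \<in> Ln L"
  shows "\<exists>P\<in>hpoints. P \<subseteq> l \<and> P \<subseteq> l'"
proof -
  obtain m where m: "\<not> small m" "l = ker m" "near m = L" using l unfolding Ln_def by blast
  obtain m' where m': "\<not> small m'" "l' = ker m'" "near m' = L" using l unfolding Ln_def by blast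
  obtain x y z a b where d: "db x y z a b m" using db_ex_for_row[OF m(1)] by blast
  note dots = db_dots[OF d]
  have "\<exists>v. \<not> small v \<and> dot m v = 0 \<and> dot m' v = 0"
  proof (cases "dot m' x = 0")
    case True
    then show ?thesis using dots db_not_small(1)[OF d] by blast
  next
    case False
    have "x \<in> near m" "y \<in> near m" unfolding near_def using dots N_zero by auto
    then have "dot m' x \<in> N" "dot m' y \<in> N" using m(3) m'(3) unfolding near_def by auto
    then obtain r where r: "dot m' y = dot m' x * r" using N_gen_right[of "dot m' x"] False by blast
    have "\<not> small (y - vsmul x r)"
    proof
      assume "small (y - vsmul x r)"
      from small_dot_right[OF this, of b] show False using one_notin_N by (simp add: dot_simps dots)
    qed
    moreover have "dot m (y - vsmul x r) = 0" "dot m' (y - vsmul x r) = 0"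
      using r by (simp_all add: dot_simps dots)
    ultimately show ?thesis by blast
  qed
  then obtain v where "\<not> small v" "dot m v = 0" "dot m' v = 0" by blast
  then show ?thesis using pt_hpoint[of v] m(2) m'(2) pt_sub_ker by blast
qed

text \<open>Projecting \<open>x\<close> onto the kernel along \<open>z\<close> changes it only by a
  small vector, since \<open>dot m x\<close> lies in \<open>N\<close>.\<close>

lemma line_class_ex:
  assumes l: "l \<in> Ln L" and X: "X \<in> PC" "X \<subseteq> L"
  shows "\<exists>P\<in>hpoints. pcl P = X \<and> P \<subseteq> l"
proof -
  obtain m where m: "\<not> small m" "l = ker m" "near m = L" using l unfolding Ln_def by blast
  obtain x where x: "\<not> small x" "X = nb x" using X unfolding PC_def by blast
  have mx: "dot m x \<in> N" using X(2) unfolding x(2) m(3)[symmetric] nb_sub_near .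
  obtain z where z: "dot m z = 1" using db_ex_for_row[OF m(1)] db_dots(9) by blast
  let ?v = "x - vsmul z (dot m x)"
  have s: "small (?v - vsmul x 1)"
    using small_diff[OF small_zero small_vsmul_N[OF mx, of z]] by (simp add: vec_simps)
  have "?v \<in> nb x" unfolding nb_def using s by blast
  moreover have ns: "\<not> small ?v"
  proof
    assume "small ?v"
    then have "small (?v + vsmul z (dot m x))" using small_vsmul_N[OF mx] by (intro small_add)
    then show False using x(1) by simp
  qed
  ultimately have "pcl (pt ?v) = X" using nb_eqI[of ?v x] x(2) pcl_pt by simp
  moreover have "pt ?v \<subseteq> l" unfolding m(2) pt_sub_ker by (simp add: dot_simps z)
  ultimately show ?thesis using pt_hpoint[OF ns] by blast
qed

lemma small_translate_eq:
  assumes x: "\<not> small x" and n: "small n"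
    and L: "L \<in> LC" "l \<in> Ln L" "pt x \<subseteq> l" "pt (x + n) \<subseteq> l"
    and M: "M \<in> LC" "m \<in> Ln M" "pt x \<subseteq> m" "pt (x + n) \<subseteq> m"
    and ne: "L \<noteq> M"
  shows "pt (x + n) = pt x"
proof (rule ccontr)
  assume neq: "pt (x + n) \<noteq> pt x"
  have ns: "\<not> small (x + n)" using small_diff[of "x + n" n] n x by auto
  have "small (x + n - vsmul x 1)" using n by (simp add: vec_simps)
  then have "x + n \<in> nb x" unfolding nb_def by blast
  then have "pcl (pt x) = pcl (pt (x + n))" unfolding pcl_pt using nb_eqI[OF ns] by simp
  from direction_ex1[OF pt_hpoint[OF x] pt_hpoint[OF ns] this] neq
  have "\<exists>!L. L \<in> LC \<and> (\<exists>l\<in>Ln L. pt x \<subseteq> l \<and> pt (x + n) \<subseteq> l)" by auto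
  then show False using L M ne by blast
qed

text \<open>With displacements \<open>b\<close>, \<open>c\<close>, \<open>d\<close> from
  \<open>A\<close>, the parallel sides force the parallelogram relation that \<open>d\<close> is
  \<open>b + c\<close> as far as directions can tell. Parallel diagonals then give 2
  \<open>dot h c\<close> = 0, and since 2 is a unit for odd \<open>q\<close>, \<open>C\<close> lies
  on both the \<open>M\<close>- and the \<open>H\<close>-segment of \<open>A\<close>, so
  \<open>C = A\<close>.\<close>

lemma no_fano_configuration:
  assumes q: "odd q" and P: "A \<in> hpoints" "B \<in> hpoints" "C \<in> hpoints" "D \<in> hpoints"
    and cls: "pcl B = pcl A" "pcl C = pcl A" "pcl D = pcl A"
    and ne: "C \<noteq> A" "L \<noteq> M" "M \<noteq> H" and LC: "L \<in> LC" "M \<in> LC" "H \<in> LC"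
    and L: "\<exists>l\<in>Ln L. A \<subseteq> l \<and> B \<subseteq> l" "\<exists>l\<in>Ln L. C \<subseteq> l \<and> D \<subseteq> l"
    and M: "\<exists>l\<in>Ln M. A \<subseteq> l \<and> C \<subseteq> l" "\<exists>l\<in>Ln M. B \<subseteq> l \<and> D \<subseteq> l"
    and H: "\<exists>l\<in>Ln H. A \<subseteq> l \<and> D \<subseteq> l" "\<exists>l\<in>Ln H. B \<subseteq> l \<and> C \<subseteq> l"
  shows False
proof -
  obtain x where x: "\<not> small x" "A = pt x" using hpoint_rep[OF P(1)] by blast
  have cA: "pcl A = nb x" using x pcl_pt by simp
  obtain b where b: "small b" "B = pt (x + b)" using normal_rep[OF P(2)] cls cA by metis
  obtain c where c: "small c" "C = pt (x + c)" using normal_rep[OF P(3)] cls cA by metis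
  obtain d where d: "small d" "D = pt (x + d)" using normal_rep[OF P(4)] cls cA by metis
  have diff: "\<exists>m. \<not> small m \<and> near m = K \<and> dot m x = 0 \<and> dot m s = 0 \<and> dot m (t - u) = 0"
    if K: "\<exists>l\<in>Ln K. pt x \<subseteq> l \<and> pt (x + s) \<subseteq> l" "\<exists>l\<in>Ln K. pt (x + u) \<subseteq> l \<and> pt (x + t) \<subseteq> l"
      and s: "small t" "small u" for K s t u
  proof -
    obtain m where m: "\<not> small m" "near m = K" "dot m x = 0" "dot m (x + s) = 0"
      using K(1) unfolding Ln_def by (auto simp: pt_sub_ker)
    obtain m' where m': "\<not> small m'" "near m' = K" "dot m' (x + u) = 0" "dot m' (x + t) = 0"
      using K(2) unfolding Ln_def by (auto simp: pt_sub_ker)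
    have "dot m' ((x + t) - (x + u)) = 0" unfolding dot_diff_right using m' by simp
    then have "dot m' (t - u) = 0" by simp
    then have "dot m (t - u) = 0" using same_class_dot_zero[OF m'(1) m(1) _ small_diff[OF s]] m m' by simp
    moreover have "dot m s = 0" using m by (simp add: dot_simps)
    ultimately show ?thesis using m by blast
  qed
  obtain l where l: "\<not> small l" "near l = L" "dot l x = 0" "dot l b = 0" "dot l (d - c) = 0"
    using diff[OF _ _ d(1) c(1)] L unfolding x(2) b(2) c(2) d(2) by blast
  obtain m where m: "\<not> small m" "near m = M" "dot m x = 0" "dot m c = 0" "dot m (d - b) = 0"
    using diff[OF _ _ d(1) b(1)] M unfolding x(2) b(2) c(2) d(2) by blast
  obtain h where h: "\<not> small h" "near h = H" "dot h x = 0" "dot h d = 0" "dot h (c - b) = 0"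
    using diff[OF _ _ c(1) b(1)] H unfolding x(2) b(2) c(2) d(2) by blast
  \<comment> \<open>The defect of the parallelogram relation. It need not vanish as a vector, since
    a point fixes its representative only up to a unit; what follows is that \<open>x + ?e\<close>
    represents the point \<open>A\<close> again.\<close>
  let ?e = "d - b - c"
  have se: "small ?e" using b c d by (intro small_diff)
  have ker_l: "ker l \<in> Ln L" "ker m \<in> Ln M" "ker h \<in> Ln H" using ker_in_Ln l m h by auto
  have "dot l ?e = 0" "dot m ?e = 0" using l m by (simp_all add: dot_simps)
  then have "pt (x + ?e) = pt x" using l m
    by (intro small_translate_eq[OF x(1) se LC(1) ker_l(1) _ _ LC(2) ker_l(2) _ _ ne(2)])
      (simp_all add: pt_sub_ker dot_add_right)
  moreover have "pt x \<subseteq> ker h" unfolding pt_sub_ker using h by simp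
  ultimately have "dot h (x + ?e) = 0" using pt_sub_ker by metis
  then have "dot h d = dot h b + dot h c" using h(3) by (simp add: dot_simps algebra_simps)
  moreover have "dot h c = dot h b" using h(5) by (simp add: dot_simps)
  ultimately have "dot h c * (1 + 1) = 0" using h(4) by (simp add: distrib_left del: one_add_one)
  then have hc: "dot h c = 0" using ann_right two_notin_N[OF q] by blast
  have "pt (x + c) = pt x" using h m hc
    by (intro small_translate_eq[OF x(1) c(1) LC(2) ker_l(2) _ _ LC(3) ker_l(3) _ _ ne(3)])
      (simp_all add: pt_sub_ker dot_add_right)
  then show False using ne(1) x c by simp
qed

theorem hjelmslev_plane: "hjelmslev hpoints pcl PC LC (\<subseteq>) Ln (\<subseteq>) q"
proof
  show "PC \<noteq> {}"
  proof -
    have "\<not> small (1, 0, 0)" using one_notin_N unfolding small_def by simp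
    then show ?thesis using nb_in_PC by blast
  qed
  show "pcl P \<in> PC" if P: "P \<in> hpoints" for P
    using hpoint_rep[OF P] nb_in_PC pcl_pt by metis
  show "card {L \<in> LC. X \<subseteq> L} = q + 1" if "X \<in> PC" for X
    by (rule card_line_classes[OF that])
  show "card {X \<in> PC. X \<subseteq> L} = q + 1" if "L \<in> LC" for L
    by (rule card_point_classes[OF that])
  show "\<exists>!L. L \<in> LC \<and> X \<subseteq> L \<and> Y \<subseteq> L" if "X \<in> PC" "Y \<in> PC" "X \<noteq> Y" for X Y
    by (rule class_join_ex1[OF that])
  show "pcl P \<subseteq> L" if L: "L \<in> LC" "l \<in> Ln L" and P: "P \<in> hpoints" "P \<subseteq> l" for L l P
  proof -
    obtain x where x: "P = pt x" using hpoint_rep[OF P(1)] by blast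
    obtain m where m: "l = ker m" "near m = L" using L unfolding Ln_def by blast
    have "dot m x = 0" using P(2) unfolding x m pt_sub_ker .
    then show ?thesis unfolding x m(2)[symmetric] pcl_pt nb_sub_near using N_zero by simp
  qed
  show "card {l \<in> Ln L. P \<subseteq> l} = q" if "L \<in> LC" "P \<in> hpoints" "pcl P \<subseteq> L" for L P
    by (rule card_lines_through[OF that])
  show "\<exists>!l. l \<in> Ln L \<and> P \<subseteq> l \<and> P' \<subseteq> l"
    if "L \<in> LC" "P \<in> hpoints" "P' \<in> hpoints" "pcl P \<subseteq> L" "pcl P' \<subseteq> L" "pcl P \<noteq> pcl P'" for L P P'
    by (rule line_join_ex1[OF that])
  show "P' \<subseteq> l'" if "L \<in> LC" "l \<in> Ln L" "l' \<in> Ln L" "P \<in> hpoints" "P' \<in> hpoints"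
    "pcl P = pcl P'" "P \<subseteq> l" "P' \<subseteq> l" "P \<subseteq> l'" for L l l' P P'
    by (rule segment_rigid[OF that(2-9)])
  show "\<exists>!L. L \<in> LC \<and> (\<exists>l\<in>Ln L. P \<subseteq> l \<and> P' \<subseteq> l)"
    if "P \<in> hpoints" "P' \<in> hpoints" "pcl P = pcl P'" "P \<noteq> P'" for P P'
    by (rule direction_ex1[OF that])
  show "\<exists>P\<in>hpoints. P \<subseteq> l \<and> P \<subseteq> l'" if "L \<in> LC" "l \<in> Ln L" "l' \<in> Ln L" for L l l'
    by (rule line_meet_ex[OF that(2,3)])
  show "\<exists>P\<in>hpoints. pcl P = X \<and> P \<subseteq> l" if "L \<in> LC" "l \<in> Ln L" "X \<in> PC" "X \<subseteq> L" for L l X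
    by (rule line_class_ex[OF that(2-4)])
  show False if "odd q" "a \<in> hpoints" "b \<in> hpoints" "c \<in> hpoints" "d \<in> hpoints"
      "pcl b = pcl a" "pcl c = pcl a" "pcl d = pcl a" "c \<noteq> a"
      "L \<in> LC" "M \<in> LC" "H \<in> LC" "L \<noteq> M" "M \<noteq> H"
      "\<exists>l\<in>Ln L. a \<subseteq> l \<and> b \<subseteq> l" "\<exists>l\<in>Ln L. c \<subseteq> l \<and> d \<subseteq> l"
      "\<exists>l\<in>Ln M. a \<subseteq> l \<and> c \<subseteq> l" "\<exists>l\<in>Ln M. b \<subseteq> l \<and> d \<subseteq> l"
      "\<exists>l\<in>Ln H. a \<subseteq> l \<and> d \<subseteq> l" "\<exists>l\<in>Ln H. b \<subseteq> l \<and> c \<subseteq> l" for a b c d L M H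
    by (rule no_fano_configuration[OF that(1-9) that(13,14) that(10-12) that(15-20)])
qed (use q_ge_5 in auto)

lemma proj_arc_bound:
  assumes "proj_arc (K :: 'r vec3 set set) 3"
  shows "card K \<le> (if odd q then 2 * q^2 - 2 * q + 4 else 2 * q^2 - q + 4)"
proof -
  interpret hjelmslev hpoints pcl PC LC "(\<subseteq>)" Ln "(\<subseteq>)" q by (rule hjelmslev_plane)
  interpret hjelmslev_arc hpoints pcl PC LC "(\<subseteq>)" Ln "(\<subseteq>)" q K
  proof
    show "K \<subseteq> hpoints" using assms unfolding proj_arc_def by blast
    show "card {p \<in> K. p \<subseteq> l} \<le> 3" if "L \<in> LC" "l \<in> Ln L" for L l
    proof -
      have "l \<in> hlines" using that(2) ker_in_hlines unfolding Ln_def by blast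
      then show ?thesis using assms unfolding proj_arc_def by blast
    qed
  qed
  show ?thesis by (rule arc_bound)
qed

end

theorem theorem4p12:
  fixes N :: "'r::{ring_1,finite} set" and q :: nat
  assumes "chain_ring2 N"
    and "card (UNIV :: 'r set) = q * card N"
    and "q \<ge> 5"
  shows "m_arc 3 TYPE('r) \<le> (if odd q then 2 * q^2 - 2 * q + 4 else 2 * q^2 - q + 4)"
proof -
  interpret chain_ring N q by unfold_locales (fact assms)+
  let ?S = "{card K | K. proj_arc (K :: 'r vec3 set set) 3}"
  have "proj_arc ({} :: 'r vec3 set set) 3" by (simp add: proj_arc_def)
  then have ne: "?S \<noteq> {}" by blast
  have "finite ?S" by simp
  then show ?thesis unfolding m_arc_def
    by (rule Max.boundedI[OF _ ne]) (use proj_arc_bound in blast)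
qed

end
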